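(* Let $\Gamma$ be a distance-regular graph with diameter $d\ge 3$. Let $E$ be a nontrivial minimal idempotent of $\Gamma$ and let $\{\theta_i^*\}_{i=0}^d$ be its dual eigenvalue sequence. Then $E$ is $Q$-polynomial if and only if all of the following hold: (i) $E$ is a tail, i.e. $E\circ E$ is a linear combination of $E_0$, $E$, and at most one other minimal idempotent of $\Gamma$; (ii) $E$ is three-term recurrent, i.e. there exists a complex scalar $\beta$ such that $\theta^*_{i-1}-\beta\theta^*_i+\theta^*_{i+1}$ is independent of $i$ for $1\le i\le d-1$; (iii) $\theta_i^*\ne\theta_0^*$ for $1\le i\le d$.
   Context: $\Gamma$ is a finite, undirected, connected graph without loops or multiple edges, with vertex set $X$, path-length distance $\partial$ and diameter $d$. It is distance-regular if for all $0\le h,i,j\le d$ and all $x,y\in X$ with $\partial(x,y)=h$, the number $|\{z:\partial(x,z)=i\}\cap\{z:\partial(y,z)=j\}|$ depends only on $h,i,j$. For $0\le i\le d$, $A_i$ is the $X\times X$ matrix with $(x,y)$-entry $1$ if $\partial(x,y)=i$ and $0$ otherwise; the span $M$ of $A_0,\dots,A_d$ (the Bose–Mesner algebra) has a basis $E_0,\dots,E_d$ of minimal idempotents with $E_0=|X|^{-1}J$ ($J$ the all-ones matrix), $\sum_i E_i=I$, $E_iE_j=\delta_{ij}E_i$; $E_0$ is called trivial. For a minimal idempotent $E$, its dual eigenvalues $\theta_i^*$ are defined by $E=|X|^{-1}\sum_{i=0}^d\theta_i^*A_i$. The Krein parameters $q^h_{ij}$ are defined by $E_i\circ E_j=|X|^{-1}\sum_{h=0}^d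 q^h_{ij}E_h$, where $\circ$ is the entrywise product. An ordering $E_1,\dots,E_d$ of the nontrivial minimal idempotents is $Q$-polynomial if for all $0\le i,j\le d$, $q^1_{ij}=0$ whenever $|i-j|>1$ and $q^1_{ij}\ne 0$ whenever $|i-j|=1$. A nontrivial minimal idempotent $E$ is $Q$-polynomial if there is a $Q$-polynomial ordering with $E=E_1$. *)

theory Defs
  imports "HOL-Analysis.Analysis"
begin

text \<open>
  A graph is given by its adjacency relation on a finite vertex type, so that the vertex set
  \<open>X\<close> is \<open>UNIV\<close> and \<open>X \<times> X\<close> matrices are elements of \<open>complex^'v^'v\<close>.
\<close>

definition connected_simple_graph :: "('v::finite \<Rightarrow> 'v \<Rightarrow> bool) \<Rightarrow> bool" where
  "connected_simple_graph adj \<longleftrightarrow> symp adj \<and> irreflp adj \<and> (\<forall>x y. adj\<^sup>*\<^sup>* x y)"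

text \<open>\<open>(adj ^^ n) x y\<close> says that there is a walk of length \<open>n\<close> from \<open>x\<close> to \<open>y\<close>.\<close>

definition gdist :: "('v::finite \<Rightarrow> 'v \<Rightarrow> bool) \<Rightarrow> 'v \<Rightarrow> 'v \<Rightarrow> nat" where
  "gdist adj x y = (LEAST n. (adj ^^ n) x y)"

definition diam :: "('v::finite \<Rightarrow> 'v \<Rightarrow> bool) \<Rightarrow> nat" where
  "diam adj = Max {gdist adj x y | x y. True}"

definition distance_regular :: "('v::finite \<Rightarrow> 'v \<Rightarrow> bool) \<Rightarrow> bool" where
  "distance_regular adj \<longleftrightarrow>
     connected_simple_graph adj \<and>
     (\<forall>h\<le>diam adj. \<forall>i\<le>diam adj. \<forall>j\<le>diam adj. \<exists>p. \<forall>x y. gdist adj x y = h \<longrightarrow>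
        card ({z. gdist adj x z = i} \<inter> {z. gdist adj y z = j}) = p)"

definition mscale :: "complex \<Rightarrow> complex^'v^'v \<Rightarrow> complex^'v^'v" (infixr "*\<^sub>m" 75) where
  "c *\<^sub>m A = (\<chi> x y. c * A $ x $ y)"

definition hadamard :: "complex^'v^'v \<Rightarrow> complex^'v^'v \<Rightarrow> complex^'v^'v" (infixl "\<circ>\<^sub>m" 70) where
  "A \<circ>\<^sub>m B = (\<chi> x y. A $ x $ y * B $ x $ y)"

definition distance_matrix :: "('v::finite \<Rightarrow> 'v \<Rightarrow> bool) \<Rightarrow> nat \<Rightarrow> complex^'v^'v" where
  "distance_matrix adj i = (\<chi> x y. if gdist adj x y = i then 1 else 0)"

definition bose_mesner :: "('v::finite \<Rightarrow> 'v \<Rightarrow> bool) \<Rightarrow> (complex^'v^'v) set" where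
  "bose_mesner adj = {\<Sum>i\<le>diam adj. c i *\<^sub>m distance_matrix adj i | c. True}"

text \<open>Idempotents of a commutative algebra are ordered by \<open>F \<le> E \<longleftrightarrow> E F = F\<close>.\<close>

definition minimal_idempotent :: "('v::finite \<Rightarrow> 'v \<Rightarrow> bool) \<Rightarrow> complex^'v^'v \<Rightarrow> bool" where
  "minimal_idempotent adj E \<longleftrightarrow>
     E \<in> bose_mesner adj \<and> E ** E = E \<and> E \<noteq> 0 \<and>
     (\<forall>F \<in> bose_mesner adj. F ** F = F \<and> E ** F = F \<longrightarrow> F = 0 \<or> F = E)"

definition trivial_idempotent :: "complex^'v^('v::finite)" where
  "trivial_idempotent = (1 / of_nat CARD('v)) *\<^sub>m (\<chi> x y. 1)"

definition nontrivial_minimal_idempotent ::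
    "('v::finite \<Rightarrow> 'v \<Rightarrow> bool) \<Rightarrow> complex^'v^'v \<Rightarrow> bool" where
  "nontrivial_minimal_idempotent adj E \<longleftrightarrow> minimal_idempotent adj E \<and> E \<noteq> trivial_idempotent"

text \<open>Only the values \<open>\<theta> 0, \<dots>, \<theta> d\<close> are constrained; they are uniquely determined by \<open>E\<close>.\<close>

definition dual_eigenvalues ::
    "('v::finite \<Rightarrow> 'v \<Rightarrow> bool) \<Rightarrow> complex^'v^'v \<Rightarrow> (nat \<Rightarrow> complex) \<Rightarrow> bool" where
  "dual_eigenvalues adj E \<theta> \<longleftrightarrow>
     E = (1 / of_nat CARD('v)) *\<^sub>m (\<Sum>i\<le>diam adj. \<theta> i *\<^sub>m distance_matrix adj i)"

text \<open>\<open>Es 0, \<dots>, Es d\<close> lists all minimal idempotents without repetition, the trivial one first.\<close>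

definition idempotent_ordering ::
    "('v::finite \<Rightarrow> 'v \<Rightarrow> bool) \<Rightarrow> (nat \<Rightarrow> complex^'v^'v) \<Rightarrow> bool" where
  "idempotent_ordering adj Es \<longleftrightarrow>
     Es 0 = trivial_idempotent \<and>
     bij_betw Es {1..diam adj} {E. nontrivial_minimal_idempotent adj E}"

text \<open>\<open>q h i j\<close> is the Krein parameter with upper index \<open>h\<close> and lower indices \<open>i, j\<close>; for an
  ordering of the minimal idempotents these numbers are uniquely determined when
  \<open>h, i, j \<le> d\<close>.\<close>

definition krein_parameters ::
    "('v::finite \<Rightarrow> 'v \<Rightarrow> bool) \<Rightarrow> (nat \<Rightarrow> complex^'v^'v) \<Rightarrow> (nat \<Rightarrow> nat \<Rightarrow> nat \<Rightarrow> complex) \<Rightarrow> bool"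
  where
  "krein_parameters adj Es q \<longleftrightarrow>
     (\<forall>i\<le>diam adj. \<forall>j\<le>diam adj.
        Es i \<circ>\<^sub>m Es j = (1 / of_nat CARD('v)) *\<^sub>m (\<Sum>h\<le>diam adj. q h i j *\<^sub>m Es h))"

definition Q_polynomial_ordering ::
    "('v::finite \<Rightarrow> 'v \<Rightarrow> bool) \<Rightarrow> (nat \<Rightarrow> complex^'v^'v) \<Rightarrow> bool" where
  "Q_polynomial_ordering adj Es \<longleftrightarrow>
     idempotent_ordering adj Es \<and>
     (\<exists>q. krein_parameters adj Es q \<and>
        (\<forall>i\<le>diam adj. \<forall>j\<le>diam adj.
           (\<bar>int i - int j\<bar> > 1 \<longrightarrow> q 1 i j = 0) \<and>
           (\<bar>int i - int j\<bar> = 1 \<longrightarrow> q 1 i j \<noteq> 0)))"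

definition Q_polynomial :: "('v::finite \<Rightarrow> 'v \<Rightarrow> bool) \<Rightarrow> complex^'v^'v \<Rightarrow> bool" where
  "Q_polynomial adj E \<longleftrightarrow> (\<exists>Es. Q_polynomial_ordering adj Es \<and> Es 1 = E)"

text \<open>\<open>S\<close> is empty or consists of the one further minimal idempotent.\<close>

definition tail :: "('v::finite \<Rightarrow> 'v \<Rightarrow> bool) \<Rightarrow> complex^'v^'v \<Rightarrow> bool" where
  "tail adj E \<longleftrightarrow>
     (\<exists>S c. S \<subseteq> {F. minimal_idempotent adj F} - {trivial_idempotent, E} \<and>
        finite S \<and> card S \<le> 1 \<and>
        E \<circ>\<^sub>m E = (\<Sum>F \<in> {trivial_idempotent, E} \<union> S. c F *\<^sub>m F))"

definition three_term_recurrent :: "nat \<Rightarrow> (nat \<Rightarrow> complex) \<Rightarrow> bool" where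
  "three_term_recurrent d \<theta> \<longleftrightarrow>
     (\<exists>\<beta> \<gamma>. \<forall>i \<in> {1..d - 1}. \<theta> (i - 1) - \<beta> * \<theta> i + \<theta> (i + 1) = \<gamma>)"

end

theory Submission
  imports Defs "HOL-Computational_Algebra.Fundamental_Theorem_Algebra"
begin

text \<open>
  Everything takes place inside the Bose--Mesner algebra \<open>M\<close>. Let \<open>H\<close> be the entrywise
  multiplication by \<open>E\<close>, and join two minimal idempotents \<open>F\<close>, \<open>G\<close> when the \<open>G\<close>-component of \<open>H F\<close> is
  nonzero; this is a symmetric relation, and \<open>E\<close> is Q-polynomial iff the resulting diagram is
  a path starting with \<open>E\<^sub>0, E\<close>.

  If it is a path, then \<open>H\<close> is tridiagonal in the basis of idempotents, so \<open>A H A\<^sup>2 - A\<^sup>2 H A\<close> equals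
  \<open>H P - P H\<close> for some \<open>P\<close> in \<open>M\<close>. Applied to \<open>I\<close>, this shows that \<open>P\<close> is supported on distances at
  most 3, and the entries at distance \<open>h + 3\<close> of both sides applied to \<open>A\<^sub>h\<close> give the three-term
  recurrence.

  Conversely, (iii) makes the diagram connected, since \<open>I\<close> is a polynomial in \<open>H\<close> applied to
  \<open>J\<close>. The recurrence yields the tridiagonal relation between \<open>H\<close> and \<open>A\<close>, which determines the
  eigenvalue of any idempotent that extends a path \<open>E\<^sub>0, E, \<dots>\<close> with at least three vertices, and
  eigenvalues separate idempotents. The first extension is unique because \<open>E\<close> is a tail.
\<close>

no_notation map_comp (infixl "\<circ>\<^sub>m" 55)

section \<open>Matrix identities\<close>

lemma mscale_nth [simp]: "(c *\<^sub>m B) $ x $ y = c * B $ x $ y"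
  by (simp add: mscale_def)

lemma hadamard_nth [simp]: "(B \<circ>\<^sub>m C) $ x $ y = B $ x $ y * C $ x $ y"
  by (simp add: hadamard_def)

lemma matrix_mult_nth: "(B ** C) $ x $ y = (\<Sum>z\<in>UNIV. B $ x $ z * C $ z $ y)"
  by (simp add: matrix_matrix_mult_def)

lemma mat_1_nth: "(mat 1 :: complex^'v^'v) $ x $ y = (if x = y then 1 else 0)"
  by (simp add: mat_def)

lemma matrix_eqI: "(\<And>x y. B $ x $ y = C $ x $ y) \<Longrightarrow> B = C"
  by (simp add: vec_eq_iff)

lemma mscale_simps [simp]:
  "0 *\<^sub>m B = 0" "1 *\<^sub>m B = B" "c *\<^sub>m 0 = 0" "b *\<^sub>m (c *\<^sub>m B) = (b * c) *\<^sub>m B"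
  by (auto intro!: matrix_eqI)

lemma mscale_eq_0_iff [simp]: "c *\<^sub>m B = 0 \<longleftrightarrow> c = 0 \<or> B = 0"
  by (auto simp: vec_eq_iff)

lemma mscale_add: "c *\<^sub>m (B + C) = c *\<^sub>m B + c *\<^sub>m C"
  by (auto intro!: matrix_eqI simp: algebra_simps)

lemma mscale_sum: "c *\<^sub>m (\<Sum>i\<in>I. f i) = (\<Sum>i\<in>I. c *\<^sub>m f i)"
  by (rule matrix_eqI) (simp add: sum_component sum_distrib_left)

lemma mscale_cancel: "B \<noteq> 0 \<Longrightarrow> b *\<^sub>m B = c *\<^sub>m B \<longleftrightarrow> b = c"
  by (auto simp: vec_eq_iff)

lemma matrix_mult_mscale [simp]:
  fixes B C :: "complex^'v^('v::finite)"
  shows "(c *\<^sub>m B) ** C = c *\<^sub>m (B ** C)" "B ** (c *\<^sub>m C) = c *\<^sub>m (B ** C)"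
  by (auto intro!: matrix_eqI simp: matrix_mult_nth sum_distrib_left mult_ac)

lemma matrix_mult_add_left:
  fixes B C D :: "complex^'v^('v::finite)"
  shows "(B + C) ** D = B ** D + C ** D"
  by (rule matrix_eqI) (simp add: matrix_mult_nth sum.distrib distrib_right)

lemma matrix_mult_diff:
  fixes B C D :: "complex^'v^('v::finite)"
  shows "(B - C) ** D = B ** D - C ** D" "D ** (B - C) = D ** B - D ** C"
  by (auto intro!: matrix_eqI simp: matrix_mult_nth sum_subtractf algebra_simps)

lemma matrix_mult_sum_left:
  fixes C :: "complex^'v^('v::finite)" and f :: "'i \<Rightarrow> complex^'v^'v"
  shows "(\<Sum>i\<in>I. f i) ** C = (\<Sum>i\<in>I. f i ** C)"
  by (induction I rule: infinite_finite_induct) (simp_all add: matrix_mult_add_left)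

lemma matrix_mult_sum_right:
  fixes C :: "complex^'v^('v::finite)" and f :: "'i \<Rightarrow> complex^'v^'v"
  shows "C ** (\<Sum>i\<in>I. f i) = (\<Sum>i\<in>I. C ** f i)"
  by (induction I rule: infinite_finite_induct) (simp_all add: matrix_add_ldistrib)

lemma hadamard_sum_right: "B \<circ>\<^sub>m (\<Sum>i\<in>I. f i) = (\<Sum>i\<in>I. B \<circ>\<^sub>m f i)"
  by (rule matrix_eqI) (simp add: sum_component sum_distrib_left)

lemma hadamard_mscale_right: "B \<circ>\<^sub>m (c *\<^sub>m C) = c *\<^sub>m (B \<circ>\<^sub>m C)"
  by (rule matrix_eqI) simp

lemma hadamard_commute: "B \<circ>\<^sub>m C = C \<circ>\<^sub>m B"
  by (rule matrix_eqI) simp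

lemma trace_mscale: "trace (c *\<^sub>m B) = c * trace B"
  by (simp add: trace_def sum_distrib_left)

lemma trace_sum: "trace (\<Sum>i\<in>I. f i) = (\<Sum>i\<in>I. trace (f i))"
  for f :: "_ \<Rightarrow> complex^'v^('v::finite)"
  by (induction I rule: infinite_finite_induct) (simp_all add: trace_add, simp_all add: trace_def)

section \<open>Polynomials evaluated at a matrix by Horner's scheme\<close>

definition mpoly :: "complex^'v^('v::finite) \<Rightarrow> complex poly \<Rightarrow> complex^'v^'v" where
  "mpoly B p = fold_coeffs (\<lambda>a C. a *\<^sub>m mat 1 + B ** C) p 0"

lemma mpoly_0 [simp]: "mpoly B 0 = 0"
  by (simp add: mpoly_def)

lemma mpoly_pCons [simp]: "mpoly B (pCons a p) = a *\<^sub>m mat 1 + B ** mpoly B p"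
  by (cases "p = 0 \<and> a = 0") (auto simp: mpoly_def)

lemma mpoly_add: "mpoly B (p + q) = mpoly B p + mpoly B q"
proof (induction p q rule: poly_induct2)
  case (pCons a p b q)
  then show ?case
    by (auto intro!: matrix_eqI simp: matrix_add_ldistrib algebra_simps)
qed simp

lemma mpoly_smult: "mpoly B (smult c p) = c *\<^sub>m mpoly B p"
  by (induction p) (auto simp: mscale_add)

lemma mpoly_diff: "mpoly B (p - q) = mpoly B p - mpoly B q"
proof -
  have "mpoly B ((p - q) + q) = mpoly B (p - q) + mpoly B q"
    by (rule mpoly_add)
  then show ?thesis
    by simp
qed

lemma mpoly_sum: "mpoly B (\<Sum>i\<in>I. f i) = (\<Sum>i\<in>I. mpoly B (f i))"
  by (induction I rule: infinite_finite_induct) (simp_all add: mpoly_add)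

lemma mpoly_mult: "mpoly B (p * q) = mpoly B p ** mpoly B q"
  by (induction p) (simp_all add: mpoly_add mpoly_smult matrix_mult_add_left matrix_mul_assoc)

lemma mpoly_mult_eigen:
  assumes "B ** C = c *\<^sub>m C"
  shows "mpoly B p ** C = poly p c *\<^sub>m C"
proof (induction p)
  case (pCons a p)
  have "mpoly B (pCons a p) ** C = a *\<^sub>m C + B ** (mpoly B p ** C)"
    by (simp add: matrix_mult_add_left matrix_mul_assoc)
  also have "\<dots> = a *\<^sub>m C + poly p c *\<^sub>m (c *\<^sub>m C)"
    by (simp add: pCons assms)
  finally show ?case
    by (auto intro!: matrix_eqI simp: algebra_simps)
qed simp

text \<open>Since \<open>N\<close> is symmetric, its entrywise conjugate is its adjoint, so each
  diagonal entry of the product is the sum of the squared moduli in a column of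
  \<open>N\<close>.\<close>

lemma conjugate_mult_self_eq_0:
  fixes N :: "complex^'v^('v::finite)"
  assumes "\<And>x y. N $ x $ y = N $ y $ x" and "(\<chi> x y. cnj (N $ x $ y)) ** N = 0"
  shows "N = 0"
proof (rule matrix_eqI)
  fix y x
  have "0 = (\<Sum>z\<in>UNIV. cnj (N $ x $ z) * N $ z $ x)"
    using arg_cong[OF assms(2), of "\<lambda>B. B $ x $ x"] by (simp add: matrix_mult_nth)
  also have "\<dots> = (\<Sum>z\<in>UNIV. of_real ((cmod (N $ z $ x))\<^sup>2))"
    by (intro sum.cong refl, subst assms(1)) (simp add: complex_norm_square mult.commute del: of_real_power)
  also have "\<dots> = of_real (\<Sum>z\<in>UNIV. (cmod (N $ z $ x))\<^sup>2)"
    by simp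
  finally have "(\<Sum>z\<in>UNIV. (cmod (N $ z $ x))\<^sup>2) = 0"
    by (metis of_real_eq_0_iff)
  then show "N $ y $ x = 0 $ y $ x"
    by (simp add: sum_nonneg_eq_0_iff)
qed

section \<open>Distances and the Bose--Mesner algebra\<close>

locale drg =
  fixes adj :: "'v::finite \<Rightarrow> 'v \<Rightarrow> bool"
  assumes dreg: "distance_regular adj"
begin

abbreviation vertex_dist (\<open>\<partial>\<close>) where "vertex_dist \<equiv> gdist adj"
abbreviation "d \<equiv> diam adj"
abbreviation "M \<equiv> bose_mesner adj"
abbreviation A :: "complex^'v^'v" where "A \<equiv> distance_matrix adj (Suc 0)"
abbreviation J :: "complex^'v^'v" where "J \<equiv> \<chi> x y. 1"

section \<open>Geodesics and the range of the distance\<close>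

lemma walk_gdist: "(adj ^^ \<partial> x y) x y"
proof -
  have "\<exists>n. (adj ^^ n) x y"
    using dreg by (simp add: distance_regular_def connected_simple_graph_def flip: rtranclp_power)
  then show ?thesis
    unfolding gdist_def by (rule LeastI_ex)
qed

lemma gdist_le_walk: "(adj ^^ n) x y \<Longrightarrow> \<partial> x y \<le> n"
  unfolding gdist_def by (rule Least_le)

lemma gdist_triangle: "\<partial> x z \<le> \<partial> x y + \<partial> y z"
  by (meson gdist_le_walk relpowp_trans walk_gdist)

lemma gdist_sym: "\<partial> x y = \<partial> y x"
proof -
  have sym: "adj u v \<Longrightarrow> adj v u" for u v
    using dreg by (auto simp: distance_regular_def connected_simple_graph_def dest: sympD)
  have "(adj ^^ n) u v \<Longrightarrow> (adj ^^ n) v u" for n u v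
  proof (induction n arbitrary: v)
    case (Suc n)
    then show ?case
      by (metis relpowp_Suc_E relpowp_Suc_I2 sym)
  qed simp
  then show ?thesis
    by (meson gdist_le_walk walk_gdist order_antisym)
qed

lemma gdist_eq_0_iff [simp]: "\<partial> x y = 0 \<longleftrightarrow> x = y"
  using walk_gdist[of x y] gdist_le_walk[of 0 x y] by auto

lemma gdist_self [simp]: "\<partial> x x = 0"
  by simp

text \<open>Cut a shortest walk after \<open>i\<close> steps; by the triangle inequality neither
  piece can be shortened.\<close>

lemma gdist_split:
  assumes "\<partial> x y = i + j"
  obtains z where "\<partial> x z = i" "\<partial> z y = j"
proof -
  obtain z where "(adj ^^ i) x z" "(adj ^^ j) z y"
    using walk_gdist[of x y] unfolding assms relpowp_add by auto
  then have "\<partial> x z \<le> i" "\<partial> z y \<le> j"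
    by (auto intro: gdist_le_walk)
  then have "\<partial> x z = i" "\<partial> z y = j"
    using gdist_triangle[of x y z] assms by linarith+
  then show ?thesis
    by (rule that)
qed

lemma finite_gdist_range: "finite {\<partial> x y | x y. True}"
  by (rule finite_subset[of _ "(\<lambda>(x, y). \<partial> x y) ` UNIV"]) auto

lemma gdist_le_diam: "\<partial> x y \<le> d"
  unfolding diam_def using finite_gdist_range by (intro Max_ge) auto

lemma ex_gdist:
  assumes "i \<le> d"
  obtains x y where "\<partial> x y = i"
proof -
  have "d \<in> {\<partial> x y | x y. True}"
    unfolding diam_def using finite_gdist_range by (intro Max_in) auto
  then obtain x y where "\<partial> x y = i + (d - i)"
    using assms by auto
  then show ?thesis
    using gdist_split that by metis
qed

lemma distance_matrix_nth [simp]: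
  "distance_matrix adj i $ x $ y = (if \<partial> x y = i then 1 else 0)"
  by (simp add: distance_matrix_def)

lemma distance_matrix_sum_nth:
  "(\<Sum>i\<le>d. c i *\<^sub>m distance_matrix adj i) $ x $ y = c (\<partial> x y)"
  by (simp add: sum_component if_distrib gdist_le_diam cong: if_cong)

text \<open>The working description of \<open>M\<close>: the supports of the distance matrices
  partition the pairs of vertices, so the coefficients are just the entries.\<close>

lemma bose_mesner_iff: "B \<in> M \<longleftrightarrow> (\<exists>b. \<forall>x y. B $ x $ y = b (\<partial> x y))"
proof
  assume "B \<in> M"
  then obtain c where "B = (\<Sum>i\<le>d. c i *\<^sub>m distance_matrix adj i)"
    by (auto simp: bose_mesner_def)
  then show "\<exists>b. \<forall>x y. B $ x $ y = b (\<partial> x y)"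
    by (auto simp: distance_matrix_sum_nth)
next
  assume "\<exists>b. \<forall>x y. B $ x $ y = b (\<partial> x y)"
  then obtain b where "\<And>x y. B $ x $ y = b (\<partial> x y)"
    by auto
  then have "B = (\<Sum>i\<le>d. b i *\<^sub>m distance_matrix adj i)"
    by (intro matrix_eqI) (simp only: distance_matrix_sum_nth)
  then show "B \<in> M"
    by (auto simp: bose_mesner_def)
qed

lemma bose_mesnerE:
  assumes "B \<in> M"
  obtains b where "\<And>x y. B $ x $ y = b (\<partial> x y)"
  using assms bose_mesner_iff by auto

lemma bose_mesnerI: "(\<And>x y. B $ x $ y = b (\<partial> x y)) \<Longrightarrow> B \<in> M"
  using bose_mesner_iff by auto

lemma bm_sym: "B \<in> M \<Longrightarrow> B $ x $ y = B $ y $ x"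
  by (metis bose_mesnerE gdist_sym)

lemma bm_distance_matrix [simp]: "distance_matrix adj i \<in> M"
  by (rule bose_mesnerI[where b = "\<lambda>h. if h = i then 1 else 0"]) simp

lemma bm_0 [simp]: "0 \<in> M"
  by (rule bose_mesnerI[where b = "\<lambda>h. 0"]) simp

lemma bm_J [simp]: "J \<in> M"
  by (rule bose_mesnerI[where b = "\<lambda>h. 1"]) simp

lemma bm_id [simp]: "mat 1 \<in> M"
  by (rule bose_mesnerI[where b = "\<lambda>h. if h = 0 then 1 else 0"]) (simp add: mat_1_nth)

text \<open>All entrywise operations are treated at once; unary ones arise by taking
  \<open>C = B\<close>.\<close>

lemma bm_pointwise:
  assumes "B \<in> M" "C \<in> M" "\<And>x y. D $ x $ y = f (B $ x $ y) (C $ x $ y)"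
  shows "D \<in> M"
proof -
  obtain b where b: "\<And>x y. B $ x $ y = b (\<partial> x y)" using bose_mesnerE[OF assms(1)] by blast
  obtain c where c: "\<And>x y. C $ x $ y = c (\<partial> x y)" using bose_mesnerE[OF assms(2)] by blast
  show ?thesis
    by (rule bose_mesnerI[where b = "\<lambda>h. f (b h) (c h)"]) (simp add: assms(3) b c)
qed

lemma bm_mscale [simp]: "B \<in> M \<Longrightarrow> c *\<^sub>m B \<in> M"
  by (rule bm_pointwise[where B = B and C = B and f = "\<lambda>u v. c * u"]) simp_all

lemma bm_add [simp]: "B \<in> M \<Longrightarrow> C \<in> M \<Longrightarrow> B + C \<in> M"
  by (rule bm_pointwise[where B = B and C = C and f = "(+)"]) simp_all

lemma bm_diff [simp]: "B \<in> M \<Longrightarrow> C \<in> M \<Longrightarrow> B - C \<in> M"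
  by (rule bm_pointwise[where B = B and C = C and f = "(-)"]) simp_all

lemma bm_hadamard [simp]: "B \<in> M \<Longrightarrow> C \<in> M \<Longrightarrow> B \<circ>\<^sub>m C \<in> M"
  by (rule bm_pointwise[where B = B and C = C and f = "(*)"]) simp_all

lemma bm_cnj: "B \<in> M \<Longrightarrow> (\<chi> x y. cnj (B $ x $ y)) \<in> M"
  by (rule bm_pointwise[where B = B and C = B and f = "\<lambda>u v. cnj u"]) simp_all

lemma bm_sum: "(\<And>i. i \<in> I \<Longrightarrow> f i \<in> M) \<Longrightarrow> (\<Sum>i\<in>I. f i) \<in> M"
  by (induction I rule: infinite_finite_induct) simp_all

text \<open>An entry of the product groups the vertices \<open>z\<close> by their distances to
  \<open>x\<close> and \<open>y\<close>. The group sizes are intersection numbers, which depend only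
  on \<open>\<partial> x y\<close>; this is where the regularity condition enters.\<close>

lemma bm_mult [simp]:
  assumes "B \<in> M" "C \<in> M"
  shows "B ** C \<in> M"
proof -
  \<comment> \<open>The definition asserts existence for each triple separately; choice turns this
    into a function of the three distances.\<close>
  define p where "p h i j = (SOME p. \<forall>x y. \<partial> x y = h \<longrightarrow>
    card ({z. \<partial> x z = i} \<inter> {z. \<partial> y z = j}) = p)" for h i j
  have p: "card ({z. \<partial> x z = i} \<inter> {z. \<partial> y z = j}) = p (\<partial> x y) i j"
    if "i \<le> d" "j \<le> d" for x y i j
  proof -
    have "\<forall>h\<le>d. \<forall>i\<le>d. \<forall>j\<le>d. \<exists>p. \<forall>x y. \<partial> x y = h \<longrightarrow>
        card ({z. \<partial> x z = i} \<inter> {z. \<partial> y z = j}) = p"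
      using dreg unfolding distance_regular_def by (rule conjunct2)
    note this[rule_format, OF gdist_le_diam that]
    then have "\<exists>p. \<forall>u v. \<partial> u v = \<partial> x y \<longrightarrow> card ({z. \<partial> u z = i} \<inter> {z. \<partial> v z = j}) = p"
      by blast
    from someI_ex[OF this] show ?thesis
      unfolding p_def by (elim allE[of _ x] allE[of _ y]) (rule mp, assumption, rule refl)
  qed
  obtain b where b: "\<And>x y. B $ x $ y = b (\<partial> x y)" using bose_mesnerE[OF assms(1)] by blast
  obtain c where c: "\<And>x y. C $ x $ y = c (\<partial> x y)" using bose_mesnerE[OF assms(2)] by blast
  show ?thesis
  proof (rule bose_mesnerI)
    fix x y
    have "(B ** C) $ x $ y = (\<Sum>z\<in>UNIV. b (\<partial> x z) * c (\<partial> y z))"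
      by (simp add: matrix_mult_nth b c gdist_sym[of y])
    also have "\<dots> = (\<Sum>z\<in>UNIV. \<Sum>(i, j)\<in>{..d} \<times> {..d}.
        if \<partial> x z = i \<and> \<partial> y z = j then b i * c j else 0)"
    proof (rule sum.cong[OF refl])
      fix z
      have "(\<Sum>(i, j)\<in>{..d} \<times> {..d}. if \<partial> x z = i \<and> \<partial> y z = j then b i * c j else 0)
          = (\<Sum>ij\<in>{..d} \<times> {..d}. if (\<partial> x z, \<partial> y z) = ij then b (fst ij) * c (snd ij) else 0)"
        by (intro sum.cong) (auto split: if_splits)
      then show "b (\<partial> x z) * c (\<partial> y z) =
          (\<Sum>(i, j)\<in>{..d} \<times> {..d}. if \<partial> x z = i \<and> \<partial> y z = j then b i * c j else 0)"
        by (simp add: gdist_le_diam)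
    qed
    also have "\<dots> = (\<Sum>(i, j)\<in>{..d} \<times> {..d}. b i * c j *
        of_nat (card ({z. \<partial> x z = i} \<inter> {z. \<partial> y z = j})))"
      by (subst sum.swap) (auto intro!: sum.cong simp: sum.If_cases Collect_conj_eq)
    also have "\<dots> = (\<Sum>(i, j)\<in>{..d} \<times> {..d}. b i * c j * of_nat (p (\<partial> x y) i j))"
      by (intro sum.cong) (auto simp: p)
    finally show "(B ** C) $ x $ y = (\<lambda>h. \<Sum>(i, j)\<in>{..d} \<times> {..d}. b i * c j * of_nat (p h i j)) (\<partial> x y)" .
  qed
qed

text \<open>Products stay in \<open>M\<close> and are therefore symmetric; transposing
  \<open>B ** C\<close> gives \<open>C ** B\<close>.\<close>

lemma bm_commute:
  assumes "B \<in> M" "C \<in> M"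
  shows "B ** C = C ** B"
proof (rule matrix_eqI)
  fix x y
  have "(B ** C) $ x $ y = (B ** C) $ y $ x"
    by (rule bm_sym) (simp add: assms)
  also have "\<dots> = (C ** B) $ x $ y"
    unfolding matrix_mult_nth
    by (intro sum.cong refl) (metis assms bm_sym mult.commute)
  finally show "(B ** C) $ x $ y = (C ** B) $ x $ y" .
qed

text \<open>With \<open>C\<close> the adjoint of \<open>N\<close>, commutativity turns the adjoint
  of \<open>C ** N\<close> times \<open>C ** N\<close> into \<open>C ** C ** (N ** N) = 0\<close>.
  Positivity then removes first \<open>C ** N\<close> and after it \<open>N\<close>.\<close>

lemma bm_square_eq_0:
  assumes "N \<in> M" "N ** N = 0"
  shows "N = 0"
proof -
  define C where "C = (\<chi> x y. cnj (N $ x $ y))"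
  have C: "C \<in> M"
    unfolding C_def using assms(1) by (rule bm_cnj)
  have "(\<chi> x y. cnj ((C ** N) $ x $ y)) = N ** C"
    unfolding C_def by (rule matrix_eqI) (simp add: matrix_mult_nth)
  moreover have "(N ** C) ** (C ** N) = C ** C ** (N ** N)"
    using bm_commute[OF C assms(1)] by (metis matrix_mul_assoc)
  ultimately have "C ** N = 0"
    using assms C by - (rule conjugate_mult_self_eq_0, simp_all add: bm_sym[of "C ** N"])
  then show ?thesis
    unfolding C_def using bm_sym[OF assms(1)] by - (rule conjugate_mult_self_eq_0)
qed

text \<open>Once \<open>B = C ** B\<close> is known for the adjoint \<open>C\<close>, the trace is
  the sum of the squared moduli of all entries of \<open>B\<close>.\<close>

lemma trace_idempotent_neq_0:
  assumes "B \<in> M" "B ** B = B" "B \<noteq> 0"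
  shows "trace B \<noteq> 0"
proof
  assume tr: "trace B = 0"
  define C where "C = (\<chi> x y. cnj (B $ x $ y))"
  have C: "C \<in> M"
    unfolding C_def using assms(1) by (rule bm_cnj)
  have CC: "C ** C = C"
  proof (rule matrix_eqI)
    fix x y
    have "cnj ((B ** B) $ x $ y) = C $ x $ y"
      by (simp add: assms C_def)
    then show "(C ** C) $ x $ y = C $ x $ y"
      by (simp add: C_def matrix_mult_nth)
  qed
  \<comment> \<open>The adjoint of \<open>N\<close> times \<open>N\<close> expands into four terms
    that cancel, because \<open>B\<close> and \<open>C\<close> are commuting idempotents.\<close>
  define N where "N = B - C ** B"
  have "(\<chi> x y. cnj (N $ x $ y)) = C - B ** C"
    unfolding N_def C_def by (rule matrix_eqI) (simp add: matrix_mult_nth)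
  moreover have "(C - B ** C) ** (B - C ** B) = 0"
  proof -
    have "C ** (C ** B) = C ** B" "B ** C ** B = C ** B" "B ** C ** (C ** B) = C ** B"
      using bm_commute[OF C assms(1)] CC assms(2) by (metis matrix_mul_assoc)+
    then show ?thesis
      by (simp add: matrix_mult_diff)
  qed
  moreover have "N \<in> M"
    unfolding N_def using assms C by simp
  ultimately have "N = 0"
    by - (rule conjugate_mult_self_eq_0, simp add: bm_sym[of N], simp add: N_def)
  then have B: "C ** B = B"
    by (simp add: N_def)
  have "0 = trace (C ** B)"
    by (simp add: tr B)
  also have "\<dots> = (\<Sum>x\<in>UNIV. \<Sum>z\<in>UNIV. of_real ((cmod (B $ x $ z))\<^sup>2))"
    unfolding trace_def matrix_mult_nth C_def
    by (intro sum.cong refl, subst (2) bm_sym[OF assms(1)])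
       (simp add: complex_norm_square mult.commute del: of_real_power)
  also have "\<dots> = of_real (\<Sum>x\<in>UNIV. \<Sum>z\<in>UNIV. (cmod (B $ x $ z))\<^sup>2)"
    by simp
  finally have "complex_of_real (\<Sum>x\<in>UNIV. \<Sum>z\<in>UNIV. (cmod (B $ x $ z))\<^sup>2) = 0"
    by (rule sym)
  then have "(\<Sum>x\<in>UNIV. \<Sum>z\<in>UNIV. (cmod (B $ x $ z))\<^sup>2) = 0"
    by (simp only: of_real_eq_0_iff)
  then have "\<forall>x z. B $ x $ z = 0"
    by (simp add: sum_nonneg_eq_0_iff sum_nonneg)
  with assms(3) show False
    by (simp add: vec_eq_iff)
qed

section \<open>The minimal idempotents\<close>

lemma bm_mpoly [simp]: "mpoly A p \<in> M"
  by (induction p) simp_all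

lemma mpoly_nth_pCons:
  "mpoly A (pCons a p) $ x $ y =
     (if x = y then a else 0) + (\<Sum>z | \<partial> x z = Suc 0. mpoly A p $ z $ y)"
  by (simp add: mat_1_nth matrix_mult_nth if_distrib[of "\<lambda>c. c * _"] sum.If_cases cong: if_cong)

text \<open>Powers of \<open>A\<close> count walks, and a walk of length \<open>n\<close> stays
  within distance \<open>n\<close>.\<close>

lemma mpoly_nth_far: "degree p < \<partial> x y \<Longrightarrow> mpoly A p $ x $ y = 0"
proof (induction p arbitrary: x)
  case (pCons a p)
  show ?case
  proof (cases "p = 0")
    case False
    have "mpoly A p $ z $ y = 0" if "\<partial> x z = Suc 0" for z
      using pCons.prems False that gdist_triangle[of x y z] by (intro pCons.IH) simp
    moreover have "x \<noteq> y"
      using pCons.prems gdist_eq_0_iff[of x y] by linarith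
    ultimately show ?thesis
      unfolding mpoly_nth_pCons by simp
  qed (use pCons.prems in \<open>auto simp: mat_1_nth\<close>)
qed simp

text \<open>At the extreme distance only the neighbours of \<open>x\<close> that are closer to
  \<open>y\<close> contribute. At least one exists, and all give the same nonzero value because
  \<open>mpoly A p\<close> lies in \<open>M\<close>, so nothing cancels.\<close>

lemma mpoly_nth_degree:
  assumes "p \<noteq> 0" "\<partial> x y = degree p"
  shows "mpoly A p $ x $ y \<noteq> 0"
  using assms
proof (induction p arbitrary: x)
  case (pCons a p)
  show ?case
  proof (cases "p = 0")
    case True
    then show ?thesis
      using pCons by (auto simp: mat_1_nth)
  next
    case False
    obtain b where b: "\<And>x y. mpoly A p $ x $ y = b (\<partial> x y)"
      using bose_mesnerE[OF bm_mpoly] by blast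
    let ?Z = "{z. \<partial> x z = Suc 0 \<and> \<partial> z y = degree p}"
    have xy: "\<partial> x y = 1 + degree p"
      using pCons.prems False by simp
    then obtain w where w: "\<partial> x w = 1" "\<partial> w y = degree p"
      by (rule gdist_split)
    have "mpoly A p $ z $ y = 0" if "\<partial> x z = Suc 0" "z \<notin> ?Z" for z
      using xy that gdist_triangle[of x y z] by (intro mpoly_nth_far) auto
    then have "(\<Sum>z | \<partial> x z = Suc 0. mpoly A p $ z $ y) = (\<Sum>z\<in>?Z. mpoly A p $ z $ y)"
      by (intro sum.mono_neutral_right) auto
    also have "\<dots> = of_nat (card ?Z) * mpoly A p $ w $ y"
    proof -
      have "mpoly A p $ z $ y = mpoly A p $ w $ y" if "z \<in> ?Z" for z
        using that w(2) by (simp only: b mem_Collect_eq)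
      then show ?thesis
        by simp
    qed
    finally have "mpoly A (pCons a p) $ x $ y = of_nat (card ?Z) * mpoly A p $ w $ y"
      using xy unfolding mpoly_nth_pCons by auto
    moreover have "card ?Z \<noteq> 0"
      using w by auto
    ultimately show ?thesis
      using pCons.IH[OF False w(2)] by simp
  qed
qed simp

text \<open>Linear independence of the powers of \<open>A\<close> up to \<open>d\<close>: a pair of
  vertices at distance \<open>degree p\<close> exposes the leading term.\<close>

lemma mpoly_eq_0:
  assumes "mpoly A p = 0" "degree p \<le> d"
  shows "p = 0"
proof (rule ccontr)
  assume "p \<noteq> 0"
  moreover obtain x y where "\<partial> x y = degree p"
    using assms(2) by (rule ex_gdist)
  ultimately show False
    using mpoly_nth_degree assms(1) by fastforce
qed

text \<open>Elimination from the largest distance downwards: a multiple of the \<open>k\<close>-th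
  power of \<open>A\<close> clears the entries at distance \<open>k\<close> and vanishes at larger
  distances.\<close>

lemma bm_eq_mpoly_aux:
  assumes "B \<in> M" "\<And>x y. k \<le> \<partial> x y \<Longrightarrow> B $ x $ y = 0"
  shows "\<exists>p. (\<forall>i\<ge>k. coeff p i = 0) \<and> B = mpoly A p"
  using assms
proof (induction k arbitrary: B)
  case 0
  then have "B = 0"
    by (intro matrix_eqI) simp
  then show ?case
    by (intro exI[of _ 0]) simp
next
  case (Suc k)
  obtain b where b: "\<And>x y. B $ x $ y = b (\<partial> x y)"
    using bose_mesnerE[OF Suc.prems(1)] by blast
  obtain w where w: "\<And>x y. mpoly A (monom 1 k) $ x $ y = w (\<partial> x y)"
    using bose_mesnerE[OF bm_mpoly] by blast
  define C where "C = B - mpoly A (smult (b k / w k) (monom 1 k))"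
  have "C $ x $ y = 0" if "k \<le> \<partial> x y" for x y
  proof (cases "\<partial> x y = k")
    case True
    then have "w k \<noteq> 0"
      using mpoly_nth_degree[of "monom 1 k" x y] w[of x y] by (simp add: degree_monom_eq)
    then show ?thesis
      using True by (simp add: C_def b w mpoly_smult del: smult_monom)
  next
    case False
    then have "mpoly A (monom 1 k) $ x $ y = 0"
      using that by (intro mpoly_nth_far) (simp add: degree_monom_eq)
    then show ?thesis
      using False that Suc.prems(2)[of x y] by (simp add: C_def mpoly_smult del: smult_monom)
  qed
  moreover have "C \<in> M"
    unfolding C_def using Suc.prems(1) by simp
  ultimately obtain p where p: "\<forall>i\<ge>k. coeff p i = 0" "C = mpoly A p"
    using Suc.IH by blast
  show ?case
  proof (intro exI conjI)
    show "B = mpoly A (p + smult (b k / w k) (monom 1 k))"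
      unfolding mpoly_add p(2)[symmetric] C_def by simp
    show "\<forall>i\<ge>Suc k. coeff (p + smult (b k / w k) (monom 1 k)) i = 0"
      using p(1) by (auto simp: Suc_le_eq)
  qed
qed

lemma bm_eq_mpoly:
  assumes "B \<in> M"
  obtains p where "B = mpoly A p" "degree p \<le> d"
proof -
  obtain p where "\<forall>i\<ge>Suc d. coeff p i = 0" "B = mpoly A p"
    using bm_eq_mpoly_aux[OF assms, of "Suc d"] gdist_le_diam by (metis not_less_eq_eq)
  then show ?thesis
    using that by (simp add: degree_le Suc_le_eq)
qed

text \<open>The minimal polynomial \<open>\<mu>\<close> of the adjacency matrix has degree \<open>d + 1\<close>. It is
  squarefree because the Bose--Mesner algebra is reduced, so Lagrange interpolation at its
  roots yields \<open>d + 1\<close> orthogonal idempotents.\<close>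

lemma spectral_idempotents:
  obtains R :: "complex set" and F :: "complex \<Rightarrow> complex^'v^'v"
  where "card R = Suc d"
    and "\<And>r. r \<in> R \<Longrightarrow> F r \<in> M" and "\<And>r. r \<in> R \<Longrightarrow> F r \<noteq> 0"
    and "\<And>r. r \<in> R \<Longrightarrow> A ** F r = r *\<^sub>m F r"
    and "\<And>r s. r \<in> R \<Longrightarrow> s \<in> R \<Longrightarrow> F r ** F s = (if r = s then F r else 0)"
    and "(\<Sum>r\<in>R. F r) = mat 1"
proof -
  \<comment> \<open>The power \<open>d + 1\<close> of \<open>A\<close> also lies in \<open>M\<close>
    and so reduces to degree at most \<open>d\<close>; the difference is monic of degree
    \<open>d + 1\<close>.\<close>
  obtain p where p: "mpoly A (monom 1 (Suc d)) = mpoly A p" "degree p \<le> d"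
    using bm_eq_mpoly[OF bm_mpoly] by blast
  define \<mu> where "\<mu> = monom 1 (Suc d) - p"
  have \<mu>0: "mpoly A \<mu> = 0"
    by (simp add: \<mu>_def mpoly_diff p)
  have "coeff \<mu> (Suc d) = 1"
    using p(2) by (simp add: \<mu>_def coeff_eq_0)
  moreover have "degree \<mu> \<le> Suc d"
    unfolding \<mu>_def using p(2) by (intro degree_diff_le) (simp_all add: degree_monom_eq)
  ultimately have deg: "degree \<mu> = Suc d"
    by (intro antisym le_degree) simp_all
  then have "\<mu> \<noteq> 0"
    by auto
  define R where "R = {r. poly \<mu> r = 0}"
  define g where "g r = \<mu> div [:- r, 1:]" for r
  have g: "\<mu> = [:- r, 1:] * g r" if "r \<in> R" for r
    unfolding g_def using that
    by (intro dvd_mult_div_cancel[symmetric]) (simp add: R_def flip: poly_eq_0_iff_dvd)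
  have deg_g: "degree (g r) = d" "g r \<noteq> 0" if "r \<in> R" for r
  proof -
    show "g r \<noteq> 0"
      using g[OF that] \<open>\<mu> \<noteq> 0\<close> by auto
    then have "degree \<mu> = 1 + degree (g r)"
      by (subst g[OF that], subst degree_mult_eq) simp_all
    then show "degree (g r) = d"
      using deg by simp
  qed
  \<comment> \<open>At a repeated root, \<open>\<mu>\<close> divides \<open>g r * g r\<close>, so
    \<open>mpoly A (g r)\<close> squares to zero and hence vanishes, although \<open>g r\<close> has
    degree \<open>d\<close>.\<close>
  have simple: "poly (g r) r \<noteq> 0" if r: "r \<in> R" for r
  proof
    assume "poly (g r) r = 0"
    then obtain f where f: "g r = [:- r, 1:] * f"
      by (auto simp: poly_eq_0_iff_dvd)
    have "mpoly A (g r) ** mpoly A (g r) = mpoly A (g r * g r)"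
      by (simp only: mpoly_mult)
    also have "g r * g r = \<mu> * f"
      by (subst (2) f, subst g[OF r]) (simp only: mult_ac)
    also have "mpoly A (\<mu> * f) = 0"
      by (simp add: mpoly_mult \<mu>0)
    finally have "mpoly A (g r) = 0"
      by - (rule bm_square_eq_0, simp_all)
    then show False
      using mpoly_eq_0 deg_g[OF r] by simp
  qed
  have "rsquarefree \<mu>"
    unfolding rsquarefree_roots
  proof (intro allI notI)
    fix r assume r: "poly \<mu> r = 0 \<and> poly (pderiv \<mu>) r = 0"
    then have "r \<in> R"
      by (simp add: R_def)
    then have "poly (pderiv \<mu>) r = poly (g r) r"
      by (subst g[of r]) (simp_all only: pderiv_mult, simp add: pderiv_pCons)
    then show False
      using r simple[OF \<open>r \<in> R\<close>] by simp
  qed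
  then have "degree \<mu> = degree (smult (lead_coeff \<mu>) (\<Prod>r\<in>R. [:- r, 1:]))"
    by (simp only: complex_poly_decompose_rsquarefree R_def)
  also have "\<dots> = card R"
    using \<open>\<mu> \<noteq> 0\<close> by (simp add: degree_prod_sum_eq)
  finally have card: "card R = Suc d"
    by (simp add: deg)
  \<comment> \<open>Lagrange basis polynomials on the roots of \<open>\<mu>\<close>.\<close>
  define e where "e r = smult (1 / poly (g r) r) (g r)" for r
  have e: "poly (e r) s = (if r = s then 1 else 0)" if "r \<in> R" "s \<in> R" for r s
  proof -
    have "(s - r) * poly (g r) s = poly \<mu> s"
      by (subst g[OF that(1)]) (simp add: algebra_simps)
    then show ?thesis
      using that simple by (auto simp: e_def R_def)
  qed
  define F where "F r = mpoly A (e r)" for r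
  have eigen: "A ** F r = r *\<^sub>m F r" if "r \<in> R" for r
  proof -
    have "A ** F r - r *\<^sub>m F r = mpoly A ([:- r, 1:] * e r)"
      unfolding mpoly_mult F_def
      by (rule matrix_eqI) (simp add: matrix_mult_add_left)
    also have "[:- r, 1:] * e r = smult (1 / poly (g r) r) \<mu>"
      by (subst g[OF that]) (simp only: e_def mult_smult_right)
    finally show ?thesis
      by (simp add: mpoly_smult \<mu>0)
  qed
  have orth: "F r ** F s = (if r = s then F r else 0)" if "r \<in> R" "s \<in> R" for r s
    using mpoly_mult_eigen[OF eigen[OF that(2)], of "e r"] e[OF that] by (simp add: F_def)
  \<comment> \<open>Both sides agree on \<open>R\<close> and have degree below
    \<open>card R\<close>.\<close>
  have "(\<Sum>r\<in>R. e r) = 1"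
  proof (rule poly_eqI_degree)
    show "poly (\<Sum>r\<in>R. e r) s = poly 1 s" if "s \<in> R" for s
    proof -
      have "finite R"
        using card card.infinite by force
      then show ?thesis
        using that by (simp add: poly_sum e)
    qed
    have "degree (e r) \<le> d" if "r \<in> R" for r
      using deg_g[OF that] by (simp add: e_def)
    then show "degree (\<Sum>r\<in>R. e r) < card R"
      unfolding card less_Suc_eq_le using card card.infinite by (intro degree_sum_le) force+
  qed (simp add: card)
  then have "(\<Sum>r\<in>R. F r) = mat 1"
    by (simp add: F_def one_pCons flip: mpoly_sum)
  moreover have "F r \<noteq> 0" if "r \<in> R" for r
  proof
    assume "F r = 0"
    then have "e r = 0"
      unfolding F_def using deg_g[OF that] by (intro mpoly_eq_0) (simp_all add: e_def)
    then show False
      using e[OF that that] by simp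
  qed
  ultimately show ?thesis
    using that[of R F] card eigen orth by (simp add: F_def)
qed

abbreviation mins :: "(complex^'v^'v) set" where "mins \<equiv> {F. minimal_idempotent adj F}"

lemma mult_eigen_bm:
  assumes "B \<in> M" "A ** C = r *\<^sub>m C"
  obtains b where "B ** C = b *\<^sub>m C"
  using assms mpoly_mult_eigen bm_eq_mpoly by metis

text \<open>Each \<open>F r\<close> is an eigenmatrix for all of \<open>M\<close>, so an idempotent
  acts on it as 0 or 1. A minimal idempotent acts as 1 on some \<open>F r\<close> and then equals
  it; the same dichotomy makes every \<open>F r\<close> minimal.\<close>

lemma mins_eq_spectral:
  fixes F :: "complex \<Rightarrow> complex^'v^'v"
  assumes M: "\<And>r. r \<in> R \<Longrightarrow> F r \<in> M" and nz: "\<And>r. r \<in> R \<Longrightarrow> F r \<noteq> 0"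
    and eigen: "\<And>r. r \<in> R \<Longrightarrow> A ** F r = r *\<^sub>m F r"
    and orth: "\<And>r s. r \<in> R \<Longrightarrow> s \<in> R \<Longrightarrow> F r ** F s = (if r = s then F r else 0)"
    and one: "(\<Sum>r\<in>R. F r) = mat 1"
  shows "mins = F ` R"
proof (intro equalityI subsetI)
  have idem: "B ** F r = 0 \<or> B ** F r = F r" if B: "B \<in> M" "B ** B = B" and r: "r \<in> R" for B r
  proof -
    obtain b where b: "B ** F r = b *\<^sub>m F r"
      using B(1) eigen[OF r] by (rule mult_eigen_bm)
    have "B ** F r = B ** (B ** F r)"
      by (simp add: matrix_mul_assoc B(2))
    then have "b *\<^sub>m F r = (b * b) *\<^sub>m F r"
      by (simp add: b)
    then have "b * b = b"
      using mscale_cancel nz r by metis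
    then show ?thesis
      by (auto simp: b)
  qed
  fix B
  {
    assume "B \<in> mins"
    then have B: "B \<in> M" "B ** B = B" "B \<noteq> 0"
      and min: "\<And>C. C \<in> M \<Longrightarrow> C ** C = C \<Longrightarrow> B ** C = C \<Longrightarrow> C = 0 \<or> C = B"
      by (auto simp: minimal_idempotent_def)
    have "(\<Sum>r\<in>R. B ** F r) = B"
      by (simp add: one flip: matrix_mult_sum_right)
    then obtain r where "r \<in> R" "B ** F r \<noteq> 0"
      using B(3) by (metis sum.neutral)
    with idem[OF B(1,2)] have "B ** F r = F r"
      by blast
    with min[of "F r"] \<open>r \<in> R\<close> have "F r = B"
      using M nz orth by auto
    with \<open>r \<in> R\<close> show "B \<in> F ` R"
      by auto
  next
    assume "B \<in> F ` R"
    then obtain r where r: "r \<in> R" "B = F r"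
      by auto
    have "C = 0 \<or> C = F r" if "C \<in> M" "C ** C = C" "F r ** C = C" for C
      using idem[OF that(1,2) r(1)] bm_commute[OF that(1) M[OF r(1)]] that(3) by simp
    then show "B \<in> mins"
      using r M nz orth by (simp add: minimal_idempotent_def)
  }
qed

lemma mins_structure:
  "finite mins" "card mins = Suc d"
  "\<Sum>mins = mat 1"
  "\<And>F G. F \<in> mins \<Longrightarrow> G \<in> mins \<Longrightarrow> F \<noteq> G \<Longrightarrow> F ** G = 0"
  "\<exists>ev. inj_on ev mins \<and> (\<forall>F\<in>mins. A ** F = ev F *\<^sub>m F)"
proof -
  obtain R F where card: "card R = Suc d"
    and M: "\<And>r. r \<in> R \<Longrightarrow> F r \<in> M" and nz: "\<And>r. r \<in> R \<Longrightarrow> F r \<noteq> 0"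
    and eigen: "\<And>r. r \<in> R \<Longrightarrow> A ** F r = r *\<^sub>m F r"
    and orth: "\<And>r s. r \<in> R \<Longrightarrow> s \<in> R \<Longrightarrow> F r ** F s = (if r = s then F r else 0)"
    and one: "(\<Sum>r\<in>R. F r) = mat 1"
    by (rule spectral_idempotents) blast
  have mins: "mins = F ` R"
    by (rule mins_eq_spectral[OF M nz eigen orth one])
  have inj: "inj_on F R"
    by (rule inj_onI) (metis orth nz)
  have "finite R"
    using card card.infinite by force
  then show "finite mins" "card mins = Suc d" "\<Sum>mins = mat 1"
    using inj card one by (simp_all add: mins card_image sum.reindex)
  show "\<And>G H. G \<in> mins \<Longrightarrow> H \<in> mins \<Longrightarrow> G \<noteq> H \<Longrightarrow> G ** H = 0"
    unfolding mins using orth by auto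
  show "\<exists>ev. inj_on ev mins \<and> (\<forall>F\<in>mins. A ** F = ev F *\<^sub>m F)"
    unfolding mins
    \<comment> \<open>The eigenvalue of \<open>F r\<close> is \<open>r\<close>, so the inverse of
      \<open>F\<close> serves as \<open>ev\<close> and is injective.\<close>
    by (intro exI[of _ "inv_into R F"] conjI inj_on_inv_into subset_refl)
       (use inj eigen in auto)
qed

lemma minsD:
  assumes "F \<in> mins"
  shows "F \<in> M" "F ** F = F" "F \<noteq> 0" "trace F \<noteq> 0"
  using assms trace_idempotent_neq_0 by (auto simp: minimal_idempotent_def)

lemma trivial_idempotent_nth [simp]:
  "(trivial_idempotent :: complex^'v^'v) $ x $ y = 1 / of_nat CARD('v)"
  by (simp add: trivial_idempotent_def)

text \<open>Left multiplication by \<open>?T\<close> averages columns, so a fixed \<open>C\<close>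
  has constant columns and, being symmetric, is a multiple of \<open>?T\<close>; idempotence leaves
  the factors 0 and 1.\<close>

lemma trivial_in_mins: "trivial_idempotent \<in> mins"
proof -
  let ?T = "trivial_idempotent :: complex^'v^'v"
  have T: "?T \<in> M"
    by (simp add: trivial_idempotent_def)
  have TT: "?T ** ?T = ?T"
    by (rule matrix_eqI) (simp add: matrix_mult_nth)
  have "C = 0 \<or> C = ?T" if C: "C \<in> M" "C ** C = C" "?T ** C = C" for C
  proof -
    have avg: "C $ x $ y = (\<Sum>z\<in>UNIV. C $ z $ y / of_nat CARD('v))" for x y
      using arg_cong[OF C(3), of "\<lambda>B. B $ x $ y"] by (simp add: matrix_mult_nth)
    have col: "C $ x $ y = C $ u $ y" for x y u
      by (rule trans[OF avg avg[symmetric]])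
    have const: "C $ x $ y = C $ u $ v" for x y u v
      by (rule trans[OF col[of x y v] trans[OF bm_sym[OF C(1)] col]])
    fix x :: 'v
    define c where "c = of_nat CARD('v) * C $ x $ x"
    have cT: "C = c *\<^sub>m ?T"
    proof (rule matrix_eqI)
      show "C $ u $ v = (c *\<^sub>m ?T) $ u $ v" for u v
        using const[of u v x x] by (simp add: c_def)
    qed
    then have "c *\<^sub>m ?T = (c * c) *\<^sub>m ?T"
      using C(2) TT by simp
    then have "c = c * c"
      by (subst (asm) mscale_cancel) (simp_all add: vec_eq_iff)
    then show ?thesis
      using cT by auto
  qed
  then show ?thesis
    using T TT by (auto simp: minimal_idempotent_def vec_eq_iff)
qed

text \<open>For \<open>B\<close> in \<open>M\<close> and a minimal idempotent \<open>F\<close>, this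
  is the coordinate of \<open>B\<close> along \<open>F\<close> and equally the eigenvalue of
  \<open>B\<close> on \<open>F\<close>. The trace formula makes it linear on all matrices.\<close>

definition coef :: "complex^'v^'v \<Rightarrow> complex^'v^'v \<Rightarrow> complex" where
  "coef F B = trace (B ** F) / trace F"

lemma coef_mscale [simp]: "coef F (c *\<^sub>m B) = c * coef F B"
  by (simp add: coef_def trace_mscale)

lemma coef_add [simp]: "coef F (B + C) = coef F B + coef F C"
  by (simp add: coef_def matrix_mult_add_left trace_add add_divide_distrib)

lemma coef_diff [simp]: "coef F (B - C) = coef F B - coef F C"
  by (simp add: coef_def matrix_mult_diff trace_sub diff_divide_distrib)

lemma coef_sum: "coef F (\<Sum>i\<in>I. f i) = (\<Sum>i\<in>I. coef F (f i))"
  by (simp add: coef_def matrix_mult_sum_left trace_sum sum_divide_distrib)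

lemma coef_eqI: "F \<in> mins \<Longrightarrow> B ** F = b *\<^sub>m F \<Longrightarrow> coef F B = b"
  using minsD(4) by (simp add: coef_def trace_mscale)

lemma mult_mins:
  assumes "F \<in> mins" "B \<in> M"
  shows "B ** F = coef F B *\<^sub>m F"
proof -
  obtain r where "A ** F = r *\<^sub>m F"
    using mins_structure(5) assms(1) by blast
  with assms(2) obtain b where "B ** F = b *\<^sub>m F"
    by (rule mult_eigen_bm)
  with coef_eqI[OF assms(1) this] show ?thesis
    by simp
qed

lemma coef_mins: "F \<in> mins \<Longrightarrow> G \<in> mins \<Longrightarrow> coef F G = (if F = G then 1 else 0)"
  using mins_structure(4)[of G F] minsD(2)[of F] by (intro coef_eqI) auto

text \<open>Simultaneous diagonalization: each \<open>coef F\<close> is a character of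
  \<open>M\<close>.\<close>

lemma coef_mult:
  assumes "F \<in> mins" "B \<in> M" "C \<in> M"
  shows "coef F (B ** C) = coef F B * coef F C"
proof (rule coef_eqI[OF assms(1)])
  have "B ** C ** F = B ** (C ** F)"
    by (simp add: matrix_mul_assoc)
  then show "B ** C ** F = (coef F B * coef F C) *\<^sub>m F"
    using assms by (simp add: mult_mins mult.commute)
qed

lemma bm_expand:
  assumes "B \<in> M"
  shows "B = (\<Sum>F\<in>mins. coef F B *\<^sub>m F)"
proof -
  have "B = (\<Sum>F\<in>mins. B ** F)"
    by (simp add: mins_structure(3) flip: matrix_mult_sum_right)
  then show ?thesis
    using mult_mins[OF _ assms] by simp
qed

lemma bm_eqI:
  assumes "B \<in> M" "C \<in> M" "\<And>F. F \<in> mins \<Longrightarrow> coef F B = coef F C"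
  shows "B = C"
  using bm_expand[OF assms(1)] bm_expand[OF assms(2)] assms(3) by simp

text \<open>Used to show that a path of idempotents has only one extension.\<close>

lemma ev_inj:
  assumes "F \<in> mins" "G \<in> mins" "coef F A = coef G A"
  shows "F = G"
proof -
  obtain ev where ev: "inj_on ev mins" "\<And>F. F \<in> mins \<Longrightarrow> A ** F = ev F *\<^sub>m F"
    using mins_structure(5) by blast
  then have "ev F = ev G"
    using assms coef_eqI by metis
  then show ?thesis
    using ev(1) assms(1,2) by (auto dest: inj_onD)
qed

text \<open>The right-hand side is symmetric in \<open>B\<close>, \<open>C\<close> and
  \<open>G\<close>, which is the source of the symmetry of the diagram.\<close>

lemma coef_hadamard_triple:
  assumes "G \<in> mins"
  shows "trace G * coef G (B \<circ>\<^sub>m C) =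
    (\<Sum>x\<in>UNIV. \<Sum>y\<in>UNIV. B $ x $ y * C $ x $ y * G $ x $ y)"
proof -
  have "trace G * coef G (B \<circ>\<^sub>m C) = trace ((B \<circ>\<^sub>m C) ** G)"
    using minsD(4)[OF assms] by (simp add: coef_def)
  also have "\<dots> = (\<Sum>x\<in>UNIV. \<Sum>y\<in>UNIV. B $ x $ y * C $ x $ y * G $ y $ x)"
    by (simp add: trace_def matrix_mult_nth)
  also have "\<dots> = (\<Sum>x\<in>UNIV. \<Sum>y\<in>UNIV. B $ x $ y * C $ x $ y * G $ x $ y)"
    by (intro sum.cong refl arg_cong2[of _ _ _ _ "(*)"] bm_sym minsD(1)[OF assms])
  finally show ?thesis .
qed

lemma coef_hadamard_swap:
  assumes "F \<in> mins" "G \<in> mins"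
  shows "coef G (B \<circ>\<^sub>m F) = 0 \<longleftrightarrow> coef F (B \<circ>\<^sub>m G) = 0"
proof -
  have "trace G * coef G (B \<circ>\<^sub>m F) = trace F * coef F (B \<circ>\<^sub>m G)"
    unfolding coef_hadamard_triple[OF assms(1)] coef_hadamard_triple[OF assms(2)]
    by (intro sum.cong refl) (simp add: mult_ac)
  then show ?thesis
    using minsD(4) assms by (metis mult_eq_0_iff)
qed

lemma coef_hadamard_expand:
  assumes "C \<in> M"
  shows "coef G (B \<circ>\<^sub>m C) = (\<Sum>F\<in>mins. coef G (B \<circ>\<^sub>m F) * coef F C)"
  by (subst bm_expand[OF assms])
     (simp add: hadamard_sum_right hadamard_mscale_right coef_sum mult.commute)

section \<open>Q-polynomial orderings as paths\<close>

lemma idempotent_ordering_iff: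
  "idempotent_ordering adj Es \<longleftrightarrow> Es 0 = trivial_idempotent \<and> bij_betw Es {..d} mins"
proof -
  have nt: "{E. nontrivial_minimal_idempotent adj E} = mins - {trivial_idempotent}"
    by (auto simp: nontrivial_minimal_idempotent_def)
  have ins: "{..d} = insert 0 {1..d}" "mins = insert trivial_idempotent (mins - {trivial_idempotent})"
    using trivial_in_mins by auto
  have "bij_betw Es {1..d} (mins - {trivial_idempotent}) \<longleftrightarrow> bij_betw Es {..d} mins"
    if "Es 0 = trivial_idempotent"
    using notIn_Un_bij_betw3[of 0 "{1..d}" Es "mins - {trivial_idempotent}"] that
    by (subst ins(1), subst (2) ins(2)) simp
  then show ?thesis
    unfolding idempotent_ordering_def nt by blast
qed

lemma sum_mins_ordering:
  assumes "bij_betw Es {..d} mins"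
  shows "(\<Sum>F\<in>mins. f F) = (\<Sum>j\<le>d. f (Es j))"
  using sum.reindex_bij_betw[OF assms] by metis

lemma ordering_in_mins: "bij_betw Es {..d} mins \<Longrightarrow> j \<le> d \<Longrightarrow> Es j \<in> mins"
  by (auto simp: bij_betw_def)

text \<open>Krein parameters are coordinates of entrywise products up to the factor
  \<open>|X|\<close>, hence determined by the ordering.\<close>

lemma krein_coef:
  assumes bij: "bij_betw Es {..d} mins" and q: "krein_parameters adj Es q"
    and "h \<le> d" "i \<le> d" "j \<le> d"
  shows "q h i j = of_nat CARD('v) * coef (Es h) (Es i \<circ>\<^sub>m Es j)"
proof -
  have h: "coef (Es h) (Es l) = (if l = h then 1 else 0)" if "l \<le> d" for l
    using coef_mins ordering_in_mins[OF bij] bij that assms(3)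
    by (auto simp: bij_betw_def dest: inj_onD)
  have "coef (Es h) (Es i \<circ>\<^sub>m Es j) =
      (1 / of_nat CARD('v)) * (\<Sum>l\<le>d. q l i j * coef (Es h) (Es l))"
    using q assms(4,5) by (simp add: krein_parameters_def coef_sum)
  also have "\<dots> = (1 / of_nat CARD('v)) * (\<Sum>l\<le>d. if l = h then q l i j else 0)"
    by (intro arg_cong[where f = "(*) _"] sum.cong) (auto simp: h)
  finally show ?thesis
    using assms(3) by simp
qed

lemma krein_parameters_exist:
  assumes bij: "bij_betw Es {..d} mins"
  shows "krein_parameters adj Es (\<lambda>h i j. of_nat CARD('v) * coef (Es h) (Es i \<circ>\<^sub>m Es j))"
  unfolding krein_parameters_def
proof (intro allI impI)
  fix i j assume "i \<le> d" "j \<le> d"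
  then have "Es i \<circ>\<^sub>m Es j = (\<Sum>F\<in>mins. coef F (Es i \<circ>\<^sub>m Es j) *\<^sub>m F)"
    using ordering_in_mins[OF bij] minsD(1) by (intro bm_expand) simp
  then show "Es i \<circ>\<^sub>m Es j = (1 / of_nat CARD('v)) *\<^sub>m
      (\<Sum>h\<le>d. (of_nat CARD('v) * coef (Es h) (Es i \<circ>\<^sub>m Es j)) *\<^sub>m Es h)"
    by (simp add: sum_mins_ordering[OF bij] mscale_sum)
qed

text \<open>Tridiagonality of entrywise multiplication by \<open>E\<close> along the ordering; the
  coordinate of \<open>E \<circ>\<^sub>m Es j\<close> along \<open>Es i\<close> takes the place of
  \<open>q 1 i j\<close>.\<close>

definition Q_path :: "complex^'v^'v \<Rightarrow> (nat \<Rightarrow> complex^'v^'v) \<Rightarrow> bool" where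
  "Q_path E Es \<longleftrightarrow> Es 0 = trivial_idempotent \<and> Es 1 = E \<and> bij_betw Es {..d} mins \<and>
     (\<forall>i\<le>d. \<forall>j\<le>d.
        (\<bar>int i - int j\<bar> > 1 \<longrightarrow> coef (Es i) (E \<circ>\<^sub>m Es j) = 0) \<and>
        (\<bar>int i - int j\<bar> = 1 \<longrightarrow> coef (Es i) (E \<circ>\<^sub>m Es j) \<noteq> 0))"

text \<open>The symmetric triple sum exchanges \<open>Es 1\<close> and \<open>Es i\<close>, so
  \<open>q 1 i j\<close> and the coordinate used in \<open>Q_path\<close> vanish together.\<close>

lemma Q_polynomial_iff_Q_path:
  assumes "d \<ge> 1"
  shows "Q_polynomial adj E \<longleftrightarrow> (\<exists>Es. Q_path E Es)"
proof -
  have swap: "coef (Es 1) (Es i \<circ>\<^sub>m Es j) = 0 \<longleftrightarrow> coef (Es i) (Es 1 \<circ>\<^sub>m Es j) = 0"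
    if "bij_betw Es {..d} mins" "i \<le> d" "j \<le> d" for Es i j
    using coef_hadamard_swap[of "Es i" "Es 1" "Es j"] ordering_in_mins[OF that(1)] that assms
    by (simp add: hadamard_commute)
  have "Q_polynomial_ordering adj Es \<longleftrightarrow> Q_path (Es 1) Es" for Es
  proof
    assume "Q_polynomial_ordering adj Es"
    then obtain q where q: "krein_parameters adj Es q" "Es 0 = trivial_idempotent"
        "bij_betw Es {..d} mins"
      and *: "\<forall>i\<le>d. \<forall>j\<le>d. (\<bar>int i - int j\<bar> > 1 \<longrightarrow> q 1 i j = 0) \<and>
           (\<bar>int i - int j\<bar> = 1 \<longrightarrow> q 1 i j \<noteq> 0)"
      unfolding Q_polynomial_ordering_def idempotent_ordering_iff by blast
    have "q 1 i j = 0 \<longleftrightarrow> coef (Es i) (Es 1 \<circ>\<^sub>m Es j) = 0" if "i \<le> d" "j \<le> d" for i j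
      using krein_coef[OF q(3,1) assms that] swap[OF q(3) that] by simp
    with * q show "Q_path (Es 1) Es"
      unfolding Q_path_def by simp
  next
    assume "Q_path (Es 1) Es"
    then have bij: "bij_betw Es {..d} mins" and "Es 0 = trivial_idempotent"
      and *: "\<forall>i\<le>d. \<forall>j\<le>d.
        (\<bar>int i - int j\<bar> > 1 \<longrightarrow> coef (Es i) (Es 1 \<circ>\<^sub>m Es j) = 0) \<and>
        (\<bar>int i - int j\<bar> = 1 \<longrightarrow> coef (Es i) (Es 1 \<circ>\<^sub>m Es j) \<noteq> 0)"
      unfolding Q_path_def by blast+
    let ?q = "\<lambda>h i j. of_nat CARD('v) * coef (Es h) (Es i \<circ>\<^sub>m Es j)"
    have "?q 1 i j = 0 \<longleftrightarrow> coef (Es i) (Es 1 \<circ>\<^sub>m Es j) = 0" if "i \<le> d" "j \<le> d" for i j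
      using swap[OF bij that] by simp
    with * have "\<forall>i\<le>d. \<forall>j\<le>d. (\<bar>int i - int j\<bar> > 1 \<longrightarrow> ?q 1 i j = 0) \<and>
           (\<bar>int i - int j\<bar> = 1 \<longrightarrow> ?q 1 i j \<noteq> 0)"
      by simp
    then show "Q_polynomial_ordering adj Es"
      unfolding Q_polynomial_ordering_def idempotent_ordering_iff
      using krein_parameters_exist[OF bij] bij \<open>Es 0 = trivial_idempotent\<close> by blast
  qed
  then show ?thesis
    unfolding Q_polynomial_def by (auto simp: Q_path_def)
qed

text \<open>Makes \<open>E\<close> the only neighbour of the trivial idempotent.\<close>

lemma hadamard_trivial: "E \<circ>\<^sub>m trivial_idempotent = (1 / of_nat CARD('v)) *\<^sub>m E"
  for E :: "complex^'v^'v"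
  by (rule matrix_eqI) simp

section \<open>From a Q-polynomial ordering to the three conditions\<close>

text \<open>The neighbours of \<open>E = Es 1\<close> on the path lie among \<open>Es 0\<close>,
  \<open>Es 1\<close> and \<open>Es 2\<close>.\<close>

lemma Q_path_tail:
  assumes "Q_path E Es" "d \<ge> 2"
  shows "tail adj E"
proof -
  note Q = assms(1)[unfolded Q_path_def]
  then have bij: "bij_betw Es {..d} mins"
    by blast
  have E: "E \<in> mins"
    using Q ordering_in_mins[OF bij, of 1] assms(2) by auto
  have ne: "Es 2 \<noteq> Es 0" "Es 2 \<noteq> Es 1"
    using bij assms(2) by (auto simp: bij_betw_def dest: inj_onD)
  have "E \<circ>\<^sub>m E = (\<Sum>F\<in>mins. coef F (E \<circ>\<^sub>m E) *\<^sub>m F)"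
    using minsD(1)[OF E] by (intro bm_expand) simp
  also have "\<dots> = (\<Sum>F\<in>{trivial_idempotent, E} \<union> {Es 2}. coef F (E \<circ>\<^sub>m E) *\<^sub>m F)"
  proof (rule sum.mono_neutral_right)
    show "{trivial_idempotent, E} \<union> {Es 2} \<subseteq> mins"
      using E trivial_in_mins ordering_in_mins[OF bij] assms(2) by auto
    show "\<forall>F\<in>mins - ({trivial_idempotent, E} \<union> {Es 2}). coef F (E \<circ>\<^sub>m E) *\<^sub>m F = 0"
    proof
      fix F assume F: "F \<in> mins - ({trivial_idempotent, E} \<union> {Es 2})"
      then obtain j where j: "j \<le> d" "F = Es j"
        using bij by (auto simp: bij_betw_def)
      then have "Es j \<noteq> Es 0" "Es j \<noteq> Es 1" "Es j \<noteq> Es 2"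
        using F Q by auto
      then have "j \<noteq> 0" "j \<noteq> 1" "j \<noteq> 2"
        by metis+
      then have "coef (Es j) (E \<circ>\<^sub>m Es 1) = 0"
        using Q j(1) assms(2) by auto
      then show "coef F (E \<circ>\<^sub>m E) *\<^sub>m F = 0"
        using Q j by simp
    qed
  qed (rule mins_structure(1))
  finally show ?thesis
    unfolding tail_def
    using ne Q ordering_in_mins[OF bij assms(2)]
    by (intro exI[of _ "{Es 2}"] exI[of _ "\<lambda>F. coef F (E \<circ>\<^sub>m E)"]) auto
qed

text \<open>Climbing the path expresses every \<open>Es k\<close> as an entrywise polynomial in
  \<open>E\<close>. Equal entries of \<open>E\<close> thus force equal entries throughout
  \<open>M\<close>, in particular in a distance matrix.\<close>

lemma Q_path_entries_distinct:
  assumes "Q_path E Es" "E $ x $ y = E $ u $ v"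
  shows "\<partial> x y = \<partial> u v"
proof -
  note Q = assms(1)[unfolded Q_path_def]
  then have bij: "bij_betw Es {..d} mins"
    by blast
  have eq: "Es k $ x $ y = Es k $ u $ v" if "k \<le> d" for k
    using that
  proof (induction k rule: less_induct)
    case (less k)
    show ?case
    proof (cases k)
      case 0
      then show ?thesis
        using Q by simp
    next
      case (Suc j)
      let ?D = "\<lambda>h. coef (Es h) (E \<circ>\<^sub>m Es j) * (Es h $ x $ y - Es h $ u $ v)"
      have "Es 1 \<in> mins" "Es j \<in> mins"
        using ordering_in_mins[OF bij] less.prems Suc by auto
      then have "E \<circ>\<^sub>m Es j = (\<Sum>F\<in>mins. coef F (E \<circ>\<^sub>m Es j) *\<^sub>m F)"
        using Q minsD(1) by (intro bm_expand bm_hadamard) auto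
      then have entry: "E $ a $ b * Es j $ a $ b =
          (\<Sum>h\<le>d. coef (Es h) (E \<circ>\<^sub>m Es j) * Es h $ a $ b)" for a b
        by (simp add: sum_mins_ordering[OF bij] vec_eq_iff sum_component)
      have "(\<Sum>h\<le>d. ?D h) = E $ x $ y * Es j $ x $ y - E $ u $ v * Es j $ u $ v"
        unfolding entry by (simp add: algebra_simps sum_subtractf)
      also have "\<dots> = 0"
        using assms(2) less.IH[of j] less.prems Suc by simp
      finally have "(\<Sum>h\<le>d. ?D h) = 0" .
      \<comment> \<open>Terms below \<open>k\<close> cancel by induction; terms above
        \<open>k = Suc j\<close> have coefficient zero.\<close>
      moreover have "(\<Sum>h\<le>d. ?D h) = (\<Sum>h\<in>{k}. ?D h)"
      proof (intro sum.mono_neutral_right ballI)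
        fix h assume h: "h \<in> {..d} - {k}"
        show "?D h = 0"
        proof (cases "h < k")
          case True
          then show ?thesis
            using less.IH[of h] h by simp
        next
          case False
          then have "coef (Es h) (E \<circ>\<^sub>m Es j) = 0"
            using Q h Suc less.prems by auto
          then show ?thesis
            by simp
        qed
      qed (use less.prems in auto)
      moreover have "coef (Es k) (E \<circ>\<^sub>m Es j) \<noteq> 0"
        using Q Suc less.prems by auto
      ultimately show ?thesis
        by simp
    qed
  qed
  define i where "i = \<partial> x y"
  have "distance_matrix adj i = (\<Sum>j\<le>d. coef (Es j) (distance_matrix adj i) *\<^sub>m Es j)"
    using bm_expand[OF bm_distance_matrix] by (simp add: sum_mins_ordering[OF bij])
  from arg_cong[OF this, of "\<lambda>B. B $ a $ b" for a b]
  have "distance_matrix adj i $ a $ b =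
      (\<Sum>j\<le>d. coef (Es j) (distance_matrix adj i) * Es j $ a $ b)" for a b
    by (simp only: sum_component mscale_nth)
  then have "distance_matrix adj i $ x $ y = distance_matrix adj i $ u $ v"
    using eq by simp
  then show ?thesis
    by (simp add: i_def split: if_splits)
qed

section \<open>Matrices supported on small distances\<close>

definition banded :: "nat \<Rightarrow> complex^'v^'v \<Rightarrow> bool" where
  "banded k B \<longleftrightarrow> (\<forall>x y. k < \<partial> x y \<longrightarrow> B $ x $ y = 0)"

lemma banded_mult: "banded k B \<Longrightarrow> banded l C \<Longrightarrow> banded (k + l) (B ** C)"
  unfolding banded_def matrix_mult_nth
proof (intro allI impI sum.neutral ballI)
  fix x y z
  assume B: "\<forall>x y. k < \<partial> x y \<longrightarrow> B $ x $ y = 0" and C: "\<forall>x y. l < \<partial> x y \<longrightarrow> C $ x $ y = 0"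
    and "k + l < \<partial> x y"
  then have "k < \<partial> x z \<or> l < \<partial> z y"
    using gdist_triangle[of x y z] by linarith
  then show "B $ x $ z * C $ z $ y = 0"
    using B C by auto
qed

lemma banded_hadamard: "banded k C \<Longrightarrow> banded k (B \<circ>\<^sub>m C)"
  by (simp add: banded_def)

lemma banded_distance_matrix: "banded i (distance_matrix adj i)"
  by (simp add: banded_def)

text \<open>At the extreme distance \<open>k + l\<close> only vertices \<open>z\<close> at distance
  \<open>k\<close> from \<open>x\<close> and \<open>l\<close> from \<open>y\<close> contribute, and
  there \<open>E\<close> has the constant value \<open>\<phi> l\<close>.\<close>

lemma mult_hadamard_leading:
  assumes "banded k B" "banded l C" "\<partial> x y = k + l" "\<And>x y. E $ x $ y = \<phi> (\<partial> x y)"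
  shows "(B ** (E \<circ>\<^sub>m C)) $ x $ y = \<phi> l * (B ** C) $ x $ y"
  unfolding matrix_mult_nth sum_distrib_left
proof (rule sum.cong[OF refl])
  fix z
  consider "k < \<partial> x z" | "l < \<partial> z y" | "\<partial> z y = l"
    using gdist_triangle[of x y z] assms(3) by linarith
  then show "B $ x $ z * (E \<circ>\<^sub>m C) $ z $ y = \<phi> l * (B $ x $ z * C $ z $ y)"
    using assms by cases (simp_all add: banded_def)
qed

text \<open>On the Bose--Mesner algebra, \<open>A H A\<^sup>2 - A\<^sup>2 H A\<close> with \<open>H\<close> the entrywise multiplication by \<open>E\<close>
  is the commutator of \<open>H\<close> with a suitable \<open>P\<close>, since \<open>H\<close> is tridiagonal in the basis \<open>Es\<close>.\<close>

lemma Q_path_commutator: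
  assumes "Q_path E Es" "d \<ge> 1"
  obtains P where "P \<in> M"
    "\<And>B. B \<in> M \<Longrightarrow> A ** (E \<circ>\<^sub>m (A ** (A ** B))) - A ** (A ** (E \<circ>\<^sub>m (A ** B))) =
       E \<circ>\<^sub>m (P ** B) - P ** (E \<circ>\<^sub>m B)"
proof -
  note Q = assms(1)[unfolded Q_path_def]
  then have bij: "bij_betw Es {..d} mins"
    by blast
  note Es = ordering_in_mins[OF bij]
  have E: "E \<in> M"
    using Q Es[OF assms(2)] minsD(1) by auto
  define t where "t j = coef (Es j) A" for j
  \<comment> \<open>Partial sums chosen so that \<open>p j - p i\<close> equals
    \<open>t i * t j * (t j - t i)\<close> across an edge, in either direction.\<close>
  define p where "p j = (\<Sum>i<j. t i * t (Suc i) * (t (Suc i) - t i))" for j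
  define P where "P = (\<Sum>j\<le>d. p j *\<^sub>m Es j)"
  have P: "P \<in> M"
    unfolding P_def using Es minsD(1) by (intro bm_sum) simp
  have cP: "coef (Es i) P = p i" if "i \<le> d" for i
  proof -
    have "coef (Es i) P = (\<Sum>j\<le>d. if j = i then p j else 0)"
      unfolding P_def coef_sum coef_mscale
      using coef_mins Es bij that
      by (intro sum.cong) (auto simp: bij_betw_def dest: inj_onD)
    then show ?thesis
      using that by simp
  qed
  have key: "coef (Es i) (E \<circ>\<^sub>m Es j) * (t i * t j * t j - t i * t i * t j) =
      coef (Es i) (E \<circ>\<^sub>m Es j) * (p j - p i)" if "i \<le> d" "j \<le> d" for i j
  proof -
    consider "\<bar>int i - int j\<bar> > 1" | "i = j" | "j = Suc i" | "i = Suc j"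
      by linarith
    then show ?thesis
    proof cases
      case 1
      then show ?thesis
        using Q that by simp
    qed (auto simp: p_def algebra_simps)
  qed
  show ?thesis
  proof (rule that[OF P], rule bm_eqI)
    fix B F assume B: "B \<in> M" and "F \<in> mins"
    then obtain i where i: "i \<le> d" "F = Es i"
      using bij by (auto simp: bij_betw_def)
    define k where "k j = coef (Es i) (E \<circ>\<^sub>m Es j)" for j
    define b where "b j = coef (Es j) B" for j
    have H: "coef (Es i) (E \<circ>\<^sub>m C) = (\<Sum>j\<le>d. k j * coef (Es j) C)" if "C \<in> M" for C
      using coef_hadamard_expand[OF that, of "Es i" E]
      by (simp add: sum_mins_ordering[OF bij] k_def)
    have "coef F (A ** (E \<circ>\<^sub>m (A ** (A ** B))) - A ** (A ** (E \<circ>\<^sub>m (A ** B)))) =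
        t i * (\<Sum>j\<le>d. k j * (t j * (t j * b j))) - t i * (t i * (\<Sum>j\<le>d. k j * (t j * b j)))"
      using i B E Es by (simp add: coef_mult H t_def b_def)
    also have "\<dots> = (\<Sum>j\<le>d. k j * (t i * t j * t j - t i * t i * t j) * b j)"
      by (simp add: sum_distrib_left algebra_simps flip: sum_subtractf)
    also have "\<dots> = (\<Sum>j\<le>d. k j * (p j - p i) * b j)"
      using key[OF i(1)] by (intro sum.cong refl arg_cong[where f = "\<lambda>c. c * _"]) (simp add: k_def)
    also have "\<dots> = (\<Sum>j\<le>d. k j * (p j * b j)) - p i * (\<Sum>j\<le>d. k j * b j)"
      by (simp add: sum_distrib_left algebra_simps flip: sum_subtractf)
    also have "\<dots> = coef F (E \<circ>\<^sub>m (P ** B) - P ** (E \<circ>\<^sub>m B))"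
      using i B E P Es by (simp add: coef_mult H cP b_def)
    finally show "coef F (A ** (E \<circ>\<^sub>m (A ** (A ** B))) - A ** (A ** (E \<circ>\<^sub>m (A ** B)))) =
        coef F (E \<circ>\<^sub>m (P ** B) - P ** (E \<circ>\<^sub>m B))" .
  qed (use E P in simp_all)
qed

text \<open>The commutator identity is read at the largest distance that matters, where
  \<open>P\<close> may be replaced by \<open>s *\<^sub>m A3\<close>; then
  \<open>r = 1 / s\<close>.\<close>

lemma Q_path_recurrence:
  assumes Q: "Q_path E Es" and "d \<ge> 3" and E: "\<And>x y. E $ x $ y = \<phi> (\<partial> x y)"
  shows "\<exists>r. \<forall>h. h + 3 \<le> d \<longrightarrow> \<phi> (h + 3) - \<phi> h = r * (\<phi> (h + 2) - \<phi> (h + 1))"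
proof -
  have inj: "\<phi> i \<noteq> \<phi> j" if "i \<noteq> j" "i \<le> d" "j \<le> d" for i j
    using Q_path_entries_distinct[OF Q] ex_gdist[OF that(2)] ex_gdist[OF that(3)] that(1) E by metis
  have "1 \<le> d"
    using assms(2) by simp
  obtain P where PM: "P \<in> M" and comm: "\<And>B. B \<in> M \<Longrightarrow>
       A ** (E \<circ>\<^sub>m (A ** (A ** B))) - A ** (A ** (E \<circ>\<^sub>m (A ** B))) =
       E \<circ>\<^sub>m (P ** B) - P ** (E \<circ>\<^sub>m B)"
    using Q_path_commutator[OF Q \<open>1 \<le> d\<close>] by blast
  obtain \<pi> where \<pi>: "\<And>x y. P $ x $ y = \<pi> (\<partial> x y)"
    using bose_mesnerE[OF PM] by blast
  have WA: "banded 1 A" "banded 2 (A ** A)"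
    using banded_distance_matrix[of 1] banded_mult[of 1 A 1 A] by (simp_all add: numeral_2_eq_2)
  have W: "banded (1 + (1 + k)) (A ** (A ** B))" if "banded k B" for k B
    using WA(1) that by (intro banded_mult)
  \<comment> \<open>Applied to the identity matrix, the left side of \<open>comm\<close> has three
    factors \<open>A\<close>, while the right side has entries \<open>(\<phi> i - \<phi> 0)\<close>
    times those of \<open>P\<close> at distance \<open>i\<close>.\<close>
  have P3: "banded 3 P"
    unfolding banded_def
  proof (intro allI impI)
    fix x y assume far: "3 < \<partial> x y"
    have "banded 0 (mat 1)"
      by (simp add: banded_def mat_1_nth)
    then have "banded (1 + (1 + (1 + 0))) (A ** (E \<circ>\<^sub>m (A ** (A ** mat 1))))"
      "banded (1 + (1 + (1 + 0))) (A ** (A ** (E \<circ>\<^sub>m (A ** mat 1))))"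
      by (intro banded_mult banded_hadamard WA(1); assumption)+
    then have "(A ** (E \<circ>\<^sub>m (A ** (A ** mat 1))) - A ** (A ** (E \<circ>\<^sub>m (A ** mat 1)))) $ x $ y = 0"
      using far by (simp add: banded_def numeral_3_eq_3)
    then have "(E \<circ>\<^sub>m (P ** mat 1) - P ** (E \<circ>\<^sub>m mat 1)) $ x $ y = 0"
      by (simp only: comm[OF bm_id])
    moreover have "E \<circ>\<^sub>m mat 1 = \<phi> 0 *\<^sub>m mat 1"
      by (rule matrix_eqI) (simp add: mat_1_nth E)
    ultimately have "(\<phi> (\<partial> x y) - \<phi> 0) * P $ x $ y = 0"
      by (simp add: E algebra_simps)
    moreover have "\<phi> (\<partial> x y) \<noteq> \<phi> 0"
      using far gdist_le_diam[of x y] by (intro inj) linarith+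
    ultimately show "P $ x $ y = 0"
      by simp
  qed
  define A3 where "A3 = A ** (A ** A)"
  have A3M: "A3 \<in> M"
    by (simp add: A3_def)
  obtain \<alpha> where \<alpha>: "\<And>x y. A3 $ x $ y = \<alpha> (\<partial> x y)"
    using bose_mesnerE[OF A3M] by blast
  have A3W: "banded 3 A3"
    using W[OF WA(1)] by (simp add: A3_def numeral_3_eq_3)
  have "mpoly A (monom 1 3) = A3"
    by (simp add: A3_def monom_Suc numeral_3_eq_3 monom_0)
  then have \<alpha>3: "\<alpha> 3 \<noteq> 0"
    using mpoly_nth_degree[of "monom 1 3"] ex_gdist[OF assms(2)] \<alpha>
    by (metis degree_monom_eq monom_eq_0_iff one_neq_zero)
  \<comment> \<open>This ratio cancels the entries of \<open>P\<close> at distance 3.\<close>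
  define s where "s = \<pi> 3 / \<alpha> 3"
  have W2: "banded 2 (P - s *\<^sub>m A3)"
    unfolding banded_def
  proof (intro allI impI)
    fix x y assume "2 < \<partial> x y"
    then consider "\<partial> x y = 3" | "3 < \<partial> x y"
      by linarith
    then show "(P - s *\<^sub>m A3) $ x $ y = 0"
    proof cases
      case 1
      then show ?thesis
        using \<alpha>3 by (simp add: \<pi> \<alpha> s_def)
    next
      case 2
      then show ?thesis
        using P3 A3W by (simp add: banded_def)
    qed
  qed
  \<comment> \<open>Both sides of \<open>comm\<close> are applied to the distance matrix of index
    \<open>h\<close> and compared at distance \<open>h + 3\<close>.\<close>
  have step: "\<phi> (h + 2) - \<phi> (h + 1) = s * (\<phi> (h + 3) - \<phi> h)" if h: "h + 3 \<le> d" for h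
  proof -
    obtain x y where xy: "\<partial> x y = h + 3"
      using ex_gdist[OF h] .
    define D where "D = distance_matrix adj h"
    have D: "D \<in> M" "banded h D"
      using banded_distance_matrix by (simp_all add: D_def)
    have A3D: "A3 ** D = A ** (A ** (A ** D))" "A3 ** D = (A ** A) ** (A ** D)"
      by (simp_all add: A3_def matrix_mul_assoc)
    have 1: "(A ** (E \<circ>\<^sub>m (A ** (A ** D)))) $ x $ y = \<phi> (h + 2) * (A3 ** D) $ x $ y"
      unfolding A3D(1) using W[OF D(2)] WA(1) xy E
      by (intro mult_hadamard_leading[where k = 1]) simp_all
    have "(A ** A ** (E \<circ>\<^sub>m (A ** D))) $ x $ y = \<phi> (h + 1) * (A3 ** D) $ x $ y"
      unfolding A3D(2) using banded_mult[OF WA(1) D(2)] WA(2) xy E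
      by (intro mult_hadamard_leading[where k = 2]) simp_all
    then have 2: "(A ** (A ** (E \<circ>\<^sub>m (A ** D)))) $ x $ y = \<phi> (h + 1) * (A3 ** D) $ x $ y"
      by (simp add: matrix_mul_assoc)
    have 3: "(P ** (E \<circ>\<^sub>m D)) $ x $ y = \<phi> h * (P ** D) $ x $ y"
      using P3 D(2) xy E by (intro mult_hadamard_leading[where k = 3]) simp_all
    have "banded (2 + h) ((P - s *\<^sub>m A3) ** D)"
      using W2 D(2) by (rule banded_mult)
    then have "((P - s *\<^sub>m A3) ** D) $ x $ y = 0"
      using xy by (simp add: banded_def)
    then have 4: "(P ** D) $ x $ y = s * (A3 ** D) $ x $ y"
      by (simp add: matrix_mult_diff)
    have "(\<phi> (h + 2) - \<phi> (h + 1)) * (A3 ** D) $ x $ y = (\<phi> (h + 3) - \<phi> h) * (P ** D) $ x $ y"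
      using arg_cong[OF comm[OF D(1)], of "\<lambda>B. B $ x $ y"] 1 2 3 xy
      by (simp add: E algebra_simps)
    then have "(\<phi> (h + 2) - \<phi> (h + 1)) * (A3 ** D) $ x $ y =
        s * (\<phi> (h + 3) - \<phi> h) * (A3 ** D) $ x $ y"
      unfolding 4 by (simp add: mult_ac)
    \<comment> \<open>Vertices at distance 3 from \<open>x\<close> and \<open>h\<close> from
      \<open>y\<close> exist, and each contributes the same nonzero
      \<open>\<alpha> 3\<close>.\<close>
    moreover have "(A3 ** D) $ x $ y \<noteq> 0"
    proof -
      let ?Z = "{z. \<partial> x z = 3 \<and> \<partial> z y = h}"
      have "(A3 ** D) $ x $ y = (\<Sum>z\<in>UNIV. if z \<in> ?Z then \<alpha> 3 else 0)"
        unfolding matrix_mult_nth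
      proof (rule sum.cong[OF refl])
        fix z
        have "A3 $ x $ z = 0" if "\<partial> x z \<noteq> 3" "\<partial> z y = h"
          using A3W that xy gdist_triangle[of x y z] by (simp add: banded_def)
        then show "A3 $ x $ z * D $ z $ y = (if z \<in> ?Z then \<alpha> 3 else 0)"
          by (auto simp: D_def \<alpha>)
      qed
      also have "\<dots> = of_nat (card ?Z) * \<alpha> 3"
        by (simp add: sum.If_cases)
      finally have "(A3 ** D) $ x $ y = of_nat (card ?Z) * \<alpha> 3" .
      moreover obtain z where "\<partial> x z = 3" "\<partial> z y = h"
        using xy gdist_split[of x y 3 h] by (auto simp: add.commute)
      then have "card ?Z \<noteq> 0"
        by auto
      ultimately show ?thesis
        using \<alpha>3 by simp
    qed
    ultimately show ?thesis
      by simp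
  qed
  \<comment> \<open>Otherwise \<open>step\<close> at \<open>h = 0\<close> would give
    \<open>\<phi> 2 = \<phi> 1\<close>.\<close>
  have "s \<noteq> 0"
    using step[of 0] inj[of 2 1] assms(2) by (auto simp: numeral_2_eq_2)
  then show ?thesis
    using step by (intro exI[of _ "1 / s"]) (simp add: field_simps)
qed

section \<open>From the three conditions to a Q-polynomial ordering\<close>

text \<open>Connectedness of the diagram: the span of a closed \<open>S\<close> is invariant under
  entrywise multiplication by \<open>E\<close> and contains \<open>J\<close>, hence also a nonzero
  multiple of the identity, whose coordinates are all nonzero.\<close>

lemma hadamard_closed_eq_mins:
  assumes EM: "E \<in> M" and E: "\<And>x y. E $ x $ y = \<phi> (\<partial> x y)"
    and \<phi>: "\<And>i. i \<in> {1..d} \<Longrightarrow> \<phi> i \<noteq> \<phi> 0"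
    and S: "S \<subseteq> mins" "trivial_idempotent \<in> S"
    and closed: "\<And>F G. F \<in> S \<Longrightarrow> G \<in> mins \<Longrightarrow> coef G (E \<circ>\<^sub>m F) \<noteq> 0 \<Longrightarrow> G \<in> S"
  shows "S = mins"
proof (rule ccontr)
  assume "S \<noteq> mins"
  then obtain G where G: "G \<in> mins" "G \<notin> S"
    using S(1) by blast
  \<comment> \<open>The span of \<open>S\<close>, described by vanishing coordinates.\<close>
  define W where "W = {B \<in> M. \<forall>G\<in>mins - S. coef G B = 0}"
  have step: "E \<circ>\<^sub>m B - c *\<^sub>m B \<in> W" if "B \<in> W" for B c
  proof -
    have "coef G (E \<circ>\<^sub>m B) = 0" if "G \<in> mins - S" for G
    proof -
      have "coef G (E \<circ>\<^sub>m F) * coef F B = 0" if "F \<in> mins" for F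
        using closed[of F G] \<open>B \<in> W\<close> \<open>G \<in> mins - S\<close> that by (cases "F \<in> S") (auto simp: W_def)
      moreover have "B \<in> M"
        using \<open>B \<in> W\<close> by (simp add: W_def)
      ultimately show ?thesis
        by (subst coef_hadamard_expand) (auto intro: sum.neutral)
    qed
    then show ?thesis
      using \<open>B \<in> W\<close> EM by (simp add: W_def)
  qed
  \<comment> \<open>Starting from \<open>J\<close>, each factor clears one more distance;
    \<open>B d\<close> retains only the diagonal.\<close>
  define B where "B k = (\<chi> x y. \<Prod>i\<in>{1..k}. \<phi> (\<partial> x y) - \<phi> i)" for k
  have "B k \<in> W" for k
  proof (induction k)
    case 0
    have "B 0 = of_nat CARD('v) *\<^sub>m trivial_idempotent"
      by (rule matrix_eqI) (simp add: B_def)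
    moreover have "coef G trivial_idempotent = 0" if "G \<in> mins - S" for G
      using that S by (subst coef_mins) auto
    ultimately show ?case
      using minsD(1)[OF trivial_in_mins] by (simp add: W_def)
  next
    case (Suc k)
    have "B (Suc k) = E \<circ>\<^sub>m B k - \<phi> (Suc k) *\<^sub>m B k"
      by (rule matrix_eqI) (simp add: B_def E prod.nat_ivl_Suc' algebra_simps)
    then show ?case
      using step[OF Suc] by simp
  qed
  then have "coef G (B d) = 0"
    using G by (auto simp: W_def)
  moreover define c where "c = (\<Prod>i\<in>{1..d}. \<phi> 0 - \<phi> i)"
  have "B d = c *\<^sub>m mat 1"
  proof (rule matrix_eqI)
    fix x y
    show "B d $ x $ y = (c *\<^sub>m mat 1) $ x $ y"
    proof (cases "x = y")
      case False
      then have "\<partial> x y \<noteq> 0"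
        by simp
      then have "1 \<le> \<partial> x y"
        by linarith
      then have "\<partial> x y \<in> {1..d}"
        using gdist_le_diam[of x y] by simp
      then show ?thesis
        using False by (auto simp: B_def mat_1_nth)
    qed (simp add: B_def c_def mat_1_nth)
  qed
  moreover have "c \<noteq> 0"
    unfolding c_def using \<phi> by (force simp: prod_zero_iff)
  moreover have "coef G (mat 1) = 1"
    using G(1) by (intro coef_eqI) simp_all
  ultimately show False
    by simp
qed

text \<open>The recurrence makes \<open>\<phi>\<^sub>i\<^sub>+\<^sub>1\<^sup>2 - \<beta> \<phi>\<^sub>i\<^sub>+\<^sub>1 \<phi>\<^sub>i + \<phi>\<^sub>i\<^sup>2 - \<gamma> (\<phi>\<^sub>i\<^sub>+\<^sub>1 + \<phi>\<^sub>i)\<close> independent of \<open>i\<close>; its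
  constant value is the \<open>\<rho>\<close> of the tridiagonal relation.\<close>

lemma tridiagonal_relation:
  assumes E: "\<And>x y. E $ x $ y = \<phi> (\<partial> x y)"
    and rec: "\<And>i. i \<in> {1..d - 1} \<Longrightarrow> \<phi> (i - 1) - \<beta> * \<phi> i + \<phi> (i + 1) = \<gamma>"
  shows "\<exists>\<rho>. \<forall>B. E \<circ>\<^sub>m (E \<circ>\<^sub>m (E \<circ>\<^sub>m (A ** B))) - (\<beta> + 1) *\<^sub>m (E \<circ>\<^sub>m (E \<circ>\<^sub>m (A ** (E \<circ>\<^sub>m B))))
      + (\<beta> + 1) *\<^sub>m (E \<circ>\<^sub>m (A ** (E \<circ>\<^sub>m (E \<circ>\<^sub>m B)))) - A ** (E \<circ>\<^sub>m (E \<circ>\<^sub>m (E \<circ>\<^sub>m B)))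
    = \<gamma> *\<^sub>m (E \<circ>\<^sub>m (E \<circ>\<^sub>m (A ** B)) - A ** (E \<circ>\<^sub>m (E \<circ>\<^sub>m B))) + \<rho> *\<^sub>m (E \<circ>\<^sub>m (A ** B) - A ** (E \<circ>\<^sub>m B))"
proof -
  define f where "f u v = u * u - \<beta> * u * v + v * v - \<gamma> * (u + v)" for u v
  define \<rho> where "\<rho> = f (\<phi> 1) (\<phi> 0)"
  have f_sym: "f u v = f v u" for u v
    by (simp add: f_def algebra_simps)
  have const: "f (\<phi> (Suc i)) (\<phi> i) = \<rho>" if "Suc i \<le> d" for i
    using that
  proof (induction i)
    case (Suc i)
    have "f (\<phi> (Suc (Suc i))) (\<phi> (Suc i)) - f (\<phi> (Suc i)) (\<phi> i) =
        (\<phi> (Suc (Suc i)) - \<phi> i) * (\<phi> i - \<beta> * \<phi> (Suc i) + \<phi> (Suc (Suc i)) - \<gamma>)"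
      by (simp add: f_def algebra_simps)
    moreover have "\<phi> i - \<beta> * \<phi> (Suc i) + \<phi> (Suc (Suc i)) = \<gamma>"
      using rec[of "Suc i"] Suc.prems by simp
    ultimately show ?case
      using Suc by simp
  qed (simp add: \<rho>_def)
  \<comment> \<open>The distances from \<open>x\<close> and \<open>z\<close> to \<open>y\<close>
    differ by at most one: equal distances kill the first factor, consecutive ones the
    second.\<close>
  have local: "(\<phi> (\<partial> x y) - \<phi> (\<partial> z y)) * (f (\<phi> (\<partial> x y)) (\<phi> (\<partial> z y)) - \<rho>) = 0"
    if "\<partial> x z = Suc 0" for x y z
  proof -
    have "\<partial> x y \<le> Suc (\<partial> z y)" "\<partial> z y \<le> Suc (\<partial> x y)"
      using gdist_triangle[of x y z] gdist_triangle[of z y x] that gdist_sym[of x z] by simp_all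
    then consider "\<partial> x y = \<partial> z y" | "\<partial> x y = Suc (\<partial> z y)" | "\<partial> z y = Suc (\<partial> x y)"
      by linarith
    then show ?thesis
      using const[of "\<partial> z y"] const[of "\<partial> x y"] gdist_le_diam[of x y] gdist_le_diam[of z y]
      by cases (auto simp: f_sym[of "\<phi> (\<partial> x y)" "\<phi> (Suc (\<partial> x y))"])
  qed
  show ?thesis
  proof (intro exI[of _ \<rho>] allI, rule matrix_eqI, goal_cases)
    case (1 B x y)
    define u where "u = \<phi> (\<partial> x y)"
    define v where "v z = \<phi> (\<partial> z y)" for z
    have ab: "(A ** C) $ x $ y = (\<Sum>z | \<partial> x z = Suc 0. C $ z $ y)" for C
      by (simp add: matrix_mult_nth if_distrib[of "\<lambda>c. c * _"] sum.If_cases cong: if_cong)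
    \<comment> \<open>Expanding this cubic in \<open>u\<close> and \<open>v z\<close> gives the
      tridiagonal relation at the entry in question: \<open>u\<close> records multiplication by
      \<open>E\<close> after \<open>A\<close>, and \<open>v z\<close> multiplication before
      it.\<close>
    have "(\<Sum>z | \<partial> x z = Suc 0. (u - v z) * (f u (v z) - \<rho>) * B $ z $ y) = 0"
      using local by (intro sum.neutral) (auto simp: u_def v_def)
    moreover have "(u - v z) * (f u (v z) - \<rho>) * B $ z $ y =
        u * (u * (u * B $ z $ y)) - (\<beta> + 1) * (u * (u * (v z * B $ z $ y)))
        + (\<beta> + 1) * (u * (v z * (v z * B $ z $ y))) - v z * (v z * (v z * B $ z $ y))
        - (\<gamma> * (u * (u * B $ z $ y) - v z * (v z * B $ z $ y)) + \<rho> * (u * B $ z $ y - v z * B $ z $ y))" for z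
      by (simp add: f_def algebra_simps)
    ultimately have "(\<Sum>z | \<partial> x z = Suc 0.
        u * (u * (u * B $ z $ y)) - (\<beta> + 1) * (u * (u * (v z * B $ z $ y)))
        + (\<beta> + 1) * (u * (v z * (v z * B $ z $ y))) - v z * (v z * (v z * B $ z $ y))
        - (\<gamma> * (u * (u * B $ z $ y) - v z * (v z * B $ z $ y)) + \<rho> * (u * B $ z $ y - v z * B $ z $ y))) = 0"
      by simp
    then show ?case
      by (simp only: vector_minus_component vector_add_component mscale_nth hadamard_nth ab E
          sum_subtractf sum.distrib u_def v_def flip: sum_distrib_left) simp
  qed
qed

text \<open>A vertex \<open>F\<close> of the representation diagram that is attached to the end of the path
  \<open>Es 0, \<dots>, Es (k + 2)\<close> is reached from \<open>Es k\<close> in three steps in only one way; the coefficient of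
  \<open>Es k\<close> in the tridiagonal relation applied to \<open>F\<close> therefore determines the eigenvalue of \<open>F\<close>.\<close>

lemma path_extension_eigenvalue:
  assumes EM: "E \<in> M" and E: "\<And>x y. E $ x $ y = \<phi> (\<partial> x y)"
    and rec: "\<And>i. i \<in> {1..d - 1} \<Longrightarrow> \<phi> (i - 1) - \<beta> * \<phi> i + \<phi> (i + 1) = \<gamma>"
    and Es: "\<And>i. i \<le> k + 2 \<Longrightarrow> Es i \<in> mins"
    and edge: "\<And>i. i < k + 2 \<Longrightarrow> coef (Es i) (E \<circ>\<^sub>m Es (Suc i)) \<noteq> 0"
    and nbrs: "\<And>i G. i < k + 2 \<Longrightarrow> G \<in> mins \<Longrightarrow> coef (Es i) (E \<circ>\<^sub>m G) \<noteq> 0 \<Longrightarrow> G \<in> Es ` {..Suc i}"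
    and F: "F \<in> mins" "F \<notin> Es ` {..k + 2}" "coef (Es (k + 2)) (E \<circ>\<^sub>m F) \<noteq> 0"
  shows "coef F A = coef (Es k) A + (\<beta> + 1) * (coef (Es (k + 2)) A - coef (Es (k + 1)) A)"
proof -
  \<comment> \<open>A calculus of lowest terms: \<open>v\<close> is the coordinate along
    \<open>Es m\<close>, and all earlier ones vanish. Multiplication by \<open>A\<close> scales
    \<open>v\<close> by \<open>t m\<close>; entrywise multiplication by \<open>E\<close> lowers the
    index by one and scales by \<open>\<kappa>\<close>.\<close>
  define V where "V m C v \<longleftrightarrow> C \<in> M \<and> (\<forall>j<m. coef (Es j) C = 0) \<and> coef (Es m) C = v" for m C v
  define \<kappa> where "\<kappa> m = coef (Es m) (E \<circ>\<^sub>m Es (Suc m))" for m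
  define t where "t m = coef (Es m) A" for m
  have VA: "V m (A ** C) (t m * v)" if "V m C v" "m \<le> k + 2" for m C v
    using that Es by (auto simp: V_def coef_mult t_def)
  have VH: "V m (E \<circ>\<^sub>m C) (\<kappa> m * v)" if V: "V (Suc m) C v" and m: "m < k + 2" for m C v
  proof -
    have C: "C \<in> M" and low: "\<And>j. j \<le> m \<Longrightarrow> coef (Es j) C = 0" and top: "coef (Es (Suc m)) C = v"
      using V by (auto simp: V_def)
    have zero: "coef (Es j) (E \<circ>\<^sub>m G) * coef G C = 0"
      if j: "j \<le> m" "j = m \<longrightarrow> G \<noteq> Es (Suc m)" and G: "G \<in> mins" for j G
    proof (rule ccontr)
      assume nz: "coef (Es j) (E \<circ>\<^sub>m G) * coef G C \<noteq> 0"
      then obtain i where i: "i \<le> Suc j" "G = Es i"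
        using nbrs[of j G] j(1) G m by auto
      then have "i \<le> m"
        using j by (metis le_SucE le_trans not_less_eq_eq order_antisym_conv)
      then show False
        using nz low i by simp
    qed
    have "coef (Es j) (E \<circ>\<^sub>m C) = 0" if "j < m" for j
      using zero[of j] that by (subst coef_hadamard_expand[OF C]) (auto intro: sum.neutral)
    moreover have "coef (Es m) (E \<circ>\<^sub>m C) = \<kappa> m * v"
    proof -
      have "coef (Es m) (E \<circ>\<^sub>m C) = (\<Sum>G\<in>{Es (Suc m)}. coef (Es m) (E \<circ>\<^sub>m G) * coef G C)"
        unfolding coef_hadamard_expand[OF C]
        using zero[of m] Es[of "Suc m"] m mins_structure(1)
        by (intro sum.mono_neutral_right) auto
      then show ?thesis
        by (simp add: \<kappa>_def top)
    qed
    ultimately show ?thesis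
      using EM C by (simp add: V_def)
  qed
  define \<delta> where "\<delta> = coef (Es (k + 2)) (E \<circ>\<^sub>m F)"
  have FM: "F \<in> M"
    using minsD(1)[OF F(1)] .
  have "coef (Es j) (E \<circ>\<^sub>m F) = 0" if "j < k + 2" for j
    using nbrs[OF that F(1)] F(2) that by fastforce
  then have V1: "V (k + 2) (E \<circ>\<^sub>m F) \<delta>"
    using EM FM by (simp add: V_def \<delta>_def)
  have V2: "V (k + 1) (E \<circ>\<^sub>m (E \<circ>\<^sub>m F)) (\<kappa> (k + 1) * \<delta>)"
    using VH[of "k + 1"] V1 by simp
  have V3: "V k (E \<circ>\<^sub>m (E \<circ>\<^sub>m (E \<circ>\<^sub>m F))) (\<kappa> k * (\<kappa> (k + 1) * \<delta>))"
    using VH[of k] V2 by simp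
  have V4: "V k (E \<circ>\<^sub>m (E \<circ>\<^sub>m (A ** (E \<circ>\<^sub>m F)))) (\<kappa> k * (\<kappa> (k + 1) * (t (k + 2) * \<delta>)))"
    using VH[OF VH] VA[OF V1] by simp
  have V5: "V k (E \<circ>\<^sub>m (A ** (E \<circ>\<^sub>m (E \<circ>\<^sub>m F)))) (\<kappa> k * (t (k + 1) * (\<kappa> (k + 1) * \<delta>)))"
    using VH[of k] VA[OF V2] by simp
  have V6: "V k (A ** (E \<circ>\<^sub>m (E \<circ>\<^sub>m (E \<circ>\<^sub>m F)))) (t k * (\<kappa> k * (\<kappa> (k + 1) * \<delta>)))"
    using VA[OF V3] by simp
  \<comment> \<open>The terms with \<open>\<gamma>\<close> and \<open>\<rho>\<close> multiply by
    \<open>E\<close> at most twice, which is too few to reach \<open>Es k\<close> from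
    \<open>F\<close>.\<close>
  have low: "coef (Es k) (E \<circ>\<^sub>m F) = 0" "coef (Es k) (E \<circ>\<^sub>m (E \<circ>\<^sub>m F)) = 0"
    "coef (Es k) (A ** (E \<circ>\<^sub>m F)) = 0" "coef (Es k) (A ** (E \<circ>\<^sub>m (E \<circ>\<^sub>m F))) = 0"
    using V1 V2 VA[OF V1] VA[OF V2] by (simp_all add: V_def)
  have AF: "A ** F = coef F A *\<^sub>m F"
    using F(1) by (intro mult_mins) simp_all
  obtain \<rho> where "E \<circ>\<^sub>m (E \<circ>\<^sub>m (E \<circ>\<^sub>m (A ** F))) - (\<beta> + 1) *\<^sub>m (E \<circ>\<^sub>m (E \<circ>\<^sub>m (A ** (E \<circ>\<^sub>m F))))
      + (\<beta> + 1) *\<^sub>m (E \<circ>\<^sub>m (A ** (E \<circ>\<^sub>m (E \<circ>\<^sub>m F)))) - A ** (E \<circ>\<^sub>m (E \<circ>\<^sub>m (E \<circ>\<^sub>m F)))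
    = \<gamma> *\<^sub>m (E \<circ>\<^sub>m (E \<circ>\<^sub>m (A ** F)) - A ** (E \<circ>\<^sub>m (E \<circ>\<^sub>m F))) + \<rho> *\<^sub>m (E \<circ>\<^sub>m (A ** F) - A ** (E \<circ>\<^sub>m F))"
    using tridiagonal_relation[OF E rec] by blast
  from arg_cong[OF this, of "coef (Es k)"]
  have "coef F A * (\<kappa> k * (\<kappa> (k + 1) * \<delta>)) - (\<beta> + 1) * (\<kappa> k * (\<kappa> (k + 1) * (t (k + 2) * \<delta>)))
     + (\<beta> + 1) * (\<kappa> k * (t (k + 1) * (\<kappa> (k + 1) * \<delta>))) - t k * (\<kappa> k * (\<kappa> (k + 1) * \<delta>)) = 0"
    using V3 V4 V5 V6 low by (simp add: V_def AF hadamard_mscale_right)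
  then have "(coef F A - (\<beta> + 1) * t (k + 2) + (\<beta> + 1) * t (k + 1) - t k) * (\<kappa> k * \<kappa> (k + 1) * \<delta>) = 0"
    by (simp add: algebra_simps)
  moreover have "\<kappa> k * \<kappa> (k + 1) * \<delta> \<noteq> 0"
    using edge F(3) by (simp add: \<kappa>_def \<delta>_def)
  ultimately have "coef F A - (\<beta> + 1) * t (k + 2) + (\<beta> + 1) * t (k + 1) - t k = 0"
    by (metis mult_eq_0_iff)
  then show ?thesis
    by (simp add: t_def algebra_simps)
qed

text \<open>All such neighbours lie in the set \<open>S\<close> supplied by \<open>tail\<close>,
  which has at most one element.\<close>

lemma tail_neighbour_unique:
  assumes "tail adj E" "E \<in> mins"
    and "F \<in> mins - {trivial_idempotent, E}" "coef F (E \<circ>\<^sub>m E) \<noteq> 0"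
    and "G \<in> mins - {trivial_idempotent, E}" "coef G (E \<circ>\<^sub>m E) \<noteq> 0"
  shows "F = G"
proof -
  obtain S c where S: "S \<subseteq> mins - {trivial_idempotent, E}" "finite S" "card S \<le> 1"
    and EE: "E \<circ>\<^sub>m E = (\<Sum>F \<in> {trivial_idempotent, E} \<union> S. c F *\<^sub>m F)"
    using assms(1) unfolding tail_def by blast
  have "H \<in> S" if "H \<in> mins - {trivial_idempotent, E}" "coef H (E \<circ>\<^sub>m E) \<noteq> 0" for H
  proof (rule ccontr)
    assume "H \<notin> S"
    then have "c F * coef H F = 0" if "F \<in> {trivial_idempotent, E} \<union> S" for F
      using that S(1) \<open>H \<in> mins - _\<close> assms(2) trivial_in_mins by (subst coef_mins) auto
    then have "coef H (E \<circ>\<^sub>m E) = 0"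
      unfolding EE coef_sum coef_mscale by (intro sum.neutral) auto
    with that(2) show False
      by contradiction
  qed
  then have "F \<in> S" "G \<in> S"
    using assms by auto
  then show ?thesis
    using S(2,3) by (metis card_le_Suc0_iff_eq One_nat_def)
qed

text \<open>Induction on \<open>k\<close>: connectedness supplies a new neighbour, which can only
  attach to the end of the path; it is unique by the tail property for \<open>k = 1\<close> and by
  its eigenvalue afterwards. The last condition leaves the end vertex \<open>Es k\<close>
  unrestricted, and \<open>i - 1\<close> truncates to 0 at the start.\<close>

lemma path_exists:
  assumes "tail adj E" and EM: "E \<in> mins" "E \<noteq> trivial_idempotent"
    and E: "\<And>x y. E $ x $ y = \<phi> (\<partial> x y)"
    and rec: "\<And>i. i \<in> {1..d - 1} \<Longrightarrow> \<phi> (i - 1) - \<beta> * \<phi> i + \<phi> (i + 1) = \<gamma>"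
    and \<phi>: "\<And>i. i \<in> {1..d} \<Longrightarrow> \<phi> i \<noteq> \<phi> 0"
    and "1 \<le> k" "k \<le> d"
  shows "\<exists>Es. Es 0 = trivial_idempotent \<and> Es 1 = E \<and> Es ` {..k} \<subseteq> mins \<and> inj_on Es {..k} \<and>
    (\<forall>i<k. coef (Es i) (E \<circ>\<^sub>m Es (Suc i)) \<noteq> 0) \<and>
    (\<forall>i<k. \<forall>G\<in>mins. coef (Es i) (E \<circ>\<^sub>m G) \<noteq> 0 \<longrightarrow> G \<in> Es ` {i - 1..Suc i})"
  using assms(7,8)
proof (induction k rule: dec_induct)
  case base
  let ?Es = "\<lambda>i::nat. if i = 0 then trivial_idempotent else E"
  have triv: "coef trivial_idempotent (E \<circ>\<^sub>m G) = 0 \<longleftrightarrow> G \<noteq> E" if "G \<in> mins" for G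
    using coef_hadamard_swap[OF that trivial_in_mins, of E] coef_mins[OF that EM(1)]
    by (simp add: hadamard_trivial)
  have "?Es ` {..1} \<subseteq> mins" "inj_on ?Es {..1}"
    using EM trivial_in_mins by (auto simp: inj_on_def)
  moreover have "G \<in> ?Es ` {0 - 1..Suc 0}" if "G = E" for G
    using that by (intro image_eqI[of _ _ 1]) auto
  ultimately show ?case
    using triv EM(1) by (intro exI[of _ ?Es]) auto
next
  case (step k)
  then obtain Es where Es0: "Es 0 = trivial_idempotent" "Es 1 = E"
    and Es: "Es ` {..k} \<subseteq> mins" and inj: "inj_on Es {..k}"
    and edge: "\<And>i. i < k \<Longrightarrow> coef (Es i) (E \<circ>\<^sub>m Es (Suc i)) \<noteq> 0"
    and nbrs: "\<And>i G. i < k \<Longrightarrow> G \<in> mins \<Longrightarrow> coef (Es i) (E \<circ>\<^sub>m G) \<noteq> 0 \<Longrightarrow> G \<in> Es ` {i - 1..Suc i}"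
    by (auto simp del: One_nat_def)
  have swap: "coef G (E \<circ>\<^sub>m F) \<noteq> 0 \<longleftrightarrow> coef F (E \<circ>\<^sub>m G) \<noteq> 0" if "F \<in> mins" "G \<in> mins" for F G
    using coef_hadamard_swap[OF that] by simp
  \<comment> \<open>Otherwise the path would be closed and exhaust \<open>mins\<close>, which has
    \<open>d + 1 > k + 1\<close> elements.\<close>
  have "\<exists>F\<in>mins - Es ` {..k}. \<exists>i\<le>k. coef F (E \<circ>\<^sub>m Es i) \<noteq> 0"
  proof (rule ccontr)
    assume closed: "\<not> ?thesis"
    have "Es ` {..k} = mins"
    proof (rule hadamard_closed_eq_mins[where \<phi> = \<phi> and E = E])
      show "trivial_idempotent \<in> Es ` {..k}"
        using Es0(1)[symmetric] by auto
    qed (use minsD(1)[OF EM(1)] E \<phi> Es closed in auto)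
    then have "Suc d = Suc k"
      using card_image[OF inj] mins_structure(2) by simp
    then show False
      using step.hyps step.prems by simp
  qed
  then obtain F i where F: "F \<in> mins" "F \<notin> Es ` {..k}" "i \<le> k" "coef F (E \<circ>\<^sub>m Es i) \<noteq> 0"
    by blast
  have Fk: "coef (Es k) (E \<circ>\<^sub>m F) \<noteq> 0"
  proof (cases "i = k")
    case True
    then show ?thesis
      using F swap[of F "Es k"] Es by auto
  next
    case False
    then have "i < k"
      using F(3) by simp
    moreover have "coef (Es i) (E \<circ>\<^sub>m F) \<noteq> 0"
      using F swap[of F "Es i"] Es by auto
    ultimately have "F \<in> Es ` {i - 1..Suc i}"
      using nbrs F(1) by blast
    then show ?thesis
      using F(2) \<open>i < k\<close> by auto
  qed
  have unique: "G = F" if G: "G \<in> mins" "G \<notin> Es ` {..k}" "coef (Es k) (E \<circ>\<^sub>m G) \<noteq> 0" for G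
  proof (cases "k = 1")
    case True
    have not01: "H \<notin> {trivial_idempotent, E}" if "H \<notin> Es ` {..k}" for H
    proof -
      have "Es 0 \<in> Es ` {..k}" "Es 1 \<in> Es ` {..k}"
        using True by blast+
      then show ?thesis
        using that Es0 by auto
    qed
    have "coef H (E \<circ>\<^sub>m E) \<noteq> 0" if "H \<in> mins" "coef (Es k) (E \<circ>\<^sub>m H) \<noteq> 0" for H
      using swap[OF that(1) EM(1)] that(2) True Es0 by simp
    then show ?thesis
      using tail_neighbour_unique[OF assms(1) EM(1), of G F] not01 G F Fk by simp
  next
    case False
    then obtain m where m: "k = m + 2"
      using step.hyps le_Suc_ex[of 2 k] by (auto simp: add.commute)
    have nbrs': "H \<in> Es ` {..Suc i}" if "i < m + 2" "H \<in> mins" "coef (Es i) (E \<circ>\<^sub>m H) \<noteq> 0" for i H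
      using nbrs[of i H] that m by auto
    \<comment> \<open>The right-hand side does not involve \<open>H\<close>, so all candidates share
      one eigenvalue.\<close>
    have "coef H A = coef (Es m) A + (\<beta> + 1) * (coef (Es (m + 2)) A - coef (Es (m + 1)) A)"
      if "H \<in> mins" "H \<notin> Es ` {..k}" "coef (Es k) (E \<circ>\<^sub>m H) \<noteq> 0" for H
    proof (rule path_extension_eigenvalue[where E = E and \<phi> = \<phi> and \<gamma> = \<gamma>])
      show "\<phi> (i - 1) - \<beta> * \<phi> i + \<phi> (i + 1) = \<gamma>" if "i \<in> {1..d - 1}" for i
        using that by (rule rec)
      show "G \<in> Es ` {..Suc i}" if "i < m + 2" "G \<in> mins" "coef (Es i) (E \<circ>\<^sub>m G) \<noteq> 0" for i G
        using that by (rule nbrs')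
    qed (use that Es edge m minsD(1)[OF EM(1)] E in auto)
    then show ?thesis
      using G F Fk by (intro ev_inj) simp_all
  qed
  define Es' where "Es' = Es(Suc k := F)"
  have Es': "Es' i = Es i" if "i \<le> k" for i
    using that by (simp add: Es'_def)
  have Es'k: "Es' (Suc k) = F"
    by (simp add: Es'_def)
  have img: "Es' ` I = Es ` I" if "I \<subseteq> {..k}" for I
    using that Es' by (intro image_cong) auto
  have "Es' 0 = trivial_idempotent" "Es' 1 = E"
    using Es0 Es' step.hyps by auto
  moreover have "Es' ` {..Suc k} \<subseteq> mins"
    using Es F(1) img[of "{..k}"] by (simp add: atMost_Suc Es'k)
  moreover have "inj_on Es' {..Suc k}"
  proof -
    have "inj_on Es' {..k}"
      using inj Es' by (subst inj_on_cong) auto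
    then show ?thesis
      using F(2) img[of "{..k}"] by (simp add: atMost_Suc Es'k)
  qed
  moreover have "coef (Es' i) (E \<circ>\<^sub>m Es' (Suc i)) \<noteq> 0" if "i < Suc k" for i
    using edge[of i] Fk that Es' by (cases "i = k") (auto simp: Es'_def)
  moreover have "G \<in> Es' ` {i - 1..Suc i}"
    if i: "i < Suc k" and G: "G \<in> mins" "coef (Es' i) (E \<circ>\<^sub>m G) \<noteq> 0" for i G
  proof (cases "i = k")
    case False
    then show ?thesis
      using nbrs[of i G] G i Es' img[of "{i - 1..Suc i}"] by auto
  next
    case True
    then have Gk: "coef (Es k) (E \<circ>\<^sub>m G) \<noteq> 0"
      using G Es' by simp
    show ?thesis
    proof (cases "G \<in> Es ` {..k}")
      case False
      then have "G = Es' (Suc k)"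
        using unique[OF G(1) _ Gk] by (simp add: Es'_def)
      then show ?thesis
        using True by auto
    next
      case True
      then obtain j where j: "j \<le> k" "G = Es j"
        by auto
      \<comment> \<open>By symmetry \<open>Es k\<close> is a neighbour of \<open>Es j\<close>; for
        \<open>Suc j < k\<close> those neighbours have index at most \<open>Suc j\<close>, against
        injectivity.\<close>
      have "k \<le> Suc j"
      proof (rule ccontr)
        assume "\<not> k \<le> Suc j"
        moreover have "coef (Es j) (E \<circ>\<^sub>m Es k) \<noteq> 0"
          using Gk swap[of "Es k" G] G(1) Es j by auto
        ultimately have "Es k \<in> Es ` {j - 1..Suc j}"
          using nbrs[of j "Es k"] Es by auto
        then obtain l where "l \<le> Suc j" "Es k = Es l"
          by auto
        then show False
          using inj \<open>\<not> k \<le> Suc j\<close> by (auto dest: inj_onD)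
      qed
      then show ?thesis
        using j \<open>i = k\<close> Es'[of j] by (intro image_eqI[of _ _ j]) auto
    qed
  qed
  ultimately show ?case
    by (intro exI[of _ Es']) blast
qed

text \<open>A path with \<open>d + 1\<close> distinct vertices uses up \<open>mins\<close>. The
  neighbour condition settles pairs with \<open>i < j\<close>, and symmetry of the diagram settles
  the others.\<close>

lemma Q_path_exists:
  assumes "tail adj E" and EM: "E \<in> mins" "E \<noteq> trivial_idempotent"
    and E: "\<And>x y. E $ x $ y = \<phi> (\<partial> x y)"
    and "three_term_recurrent d \<phi>"
    and \<phi>: "\<And>i. i \<in> {1..d} \<Longrightarrow> \<phi> i \<noteq> \<phi> 0" and "1 \<le> d"
  shows "\<exists>Es. Q_path E Es"
proof -
  obtain \<beta> \<gamma> where rec: "\<And>i. i \<in> {1..d - 1} \<Longrightarrow> \<phi> (i - 1) - \<beta> * \<phi> i + \<phi> (i + 1) = \<gamma>"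
    using assms(5) unfolding three_term_recurrent_def by blast
  obtain Es where Es0: "Es 0 = trivial_idempotent" "Es 1 = E"
    and Es: "Es ` {..d} \<subseteq> mins" and inj: "inj_on Es {..d}"
    and edge: "\<And>i. i < d \<Longrightarrow> coef (Es i) (E \<circ>\<^sub>m Es (Suc i)) \<noteq> 0"
    and nbrs: "\<And>i G. i < d \<Longrightarrow> G \<in> mins \<Longrightarrow> coef (Es i) (E \<circ>\<^sub>m G) \<noteq> 0 \<Longrightarrow> G \<in> Es ` {i - 1..Suc i}"
    using path_exists[OF assms(1) EM E rec \<phi> assms(7) order_refl]
    by (auto simp del: One_nat_def)
  have "Es ` {..d} = mins"
    using Es mins_structure(1,2) card_image[OF inj] by (intro card_subset_eq) simp_all
  then have bij: "bij_betw Es {..d} mins"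
    using inj by (simp add: bij_betw_def)
  note mem = ordering_in_mins[OF bij]
  have swap: "coef (Es i) (E \<circ>\<^sub>m Es j) = 0 \<longleftrightarrow> coef (Es j) (E \<circ>\<^sub>m Es i) = 0"
    if "i \<le> d" "j \<le> d" for i j
    using coef_hadamard_swap mem that by simp
  have up: "coef (Es i) (E \<circ>\<^sub>m Es j) = 0" if ij: "Suc i < j" "j \<le> d" for i j
  proof (rule ccontr)
    assume "coef (Es i) (E \<circ>\<^sub>m Es j) \<noteq> 0"
    then obtain l where "l \<le> Suc i" "Es j = Es l"
      using nbrs[of i "Es j"] mem ij by auto
    then show False
      using inj ij by (auto dest: inj_onD)
  qed
  have "coef (Es i) (E \<circ>\<^sub>m Es j) = 0" if "i \<le> d" "j \<le> d" "\<bar>int i - int j\<bar> > 1" for i j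
  proof (cases "i < j")
    case True
    then show ?thesis
      using that by (intro up) simp_all
  next
    case False
    then show ?thesis
      using that by (subst swap) (simp_all add: up)
  qed
  moreover have "coef (Es i) (E \<circ>\<^sub>m Es j) \<noteq> 0" if "i \<le> d" "j \<le> d" "\<bar>int i - int j\<bar> = 1" for i j
  proof -
    have "j = Suc i \<or> i = Suc j"
      using that(3) by linarith
    then show ?thesis
      using edge[of i] edge[of j] swap[OF that(1,2)] that by auto
  qed
  ultimately show ?thesis
    using Es0 bij unfolding Q_path_def by blast
qed

end

section \<open>Scalar recurrences and the equivalence\<close>

lemma three_term_recurrentI:
  fixes \<phi> :: "nat \<Rightarrow> complex"
  assumes "\<forall>h. h + 3 \<le> d \<longrightarrow> \<phi> (h + 3) - \<phi> h = r * (\<phi> (h + 2) - \<phi> (h + 1))"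
  shows "three_term_recurrent d \<phi>"
proof -
  \<comment> \<open>With \<open>\<beta> = r - 1\<close>, consecutive values of \<open>g\<close>
    differ by the two sides of the assumed relation.\<close>
  define g where "g i = \<phi> (i - 1) - (r - 1) * \<phi> i + \<phi> (i + 1)" for i
  have "g i = g 1" if "1 \<le> i" "i \<le> d - 1" for i
    using that
  proof (induction i rule: dec_induct)
    case (step i)
    then obtain h where h: "i = Suc h" "h + 3 \<le> d"
      by (cases i) auto
    have "g (Suc i) - g i = \<phi> (h + 3) - \<phi> h - r * (\<phi> (h + 2) - \<phi> (h + 1))"
      by (simp add: g_def h numeral_2_eq_2 numeral_3_eq_3 algebra_simps)
    with assms h step show ?case
      by simp
  qed simp
  then show ?thesis
    unfolding three_term_recurrent_def g_def
    by (intro exI[of _ "r - 1"] exI[of _ "g 1"]) (auto simp: g_def)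
qed

text \<open>Passes between dual eigenvalues and entries of \<open>E\<close>: \<open>\<beta>\<close>
  is kept and \<open>\<gamma>\<close> is rescaled.\<close>

lemma three_term_recurrent_scale:
  assumes "c \<noteq> 0"
  shows "three_term_recurrent d (\<lambda>i. \<theta> i / c) \<longleftrightarrow> three_term_recurrent d \<theta>"
proof -
  have "(\<theta> (i - 1) / c - \<beta> * (\<theta> i / c) + \<theta> (i + 1) / c = \<gamma>) \<longleftrightarrow>
      (\<theta> (i - 1) - \<beta> * \<theta> i + \<theta> (i + 1) = c * \<gamma>)" for i \<beta> \<gamma>
    using assms by (simp add: field_simps)
  then have "three_term_recurrent d (\<lambda>i. \<theta> i / c) \<longleftrightarrow>
      (\<exists>\<beta> \<gamma>. \<forall>i \<in> {1..d - 1}. \<theta> (i - 1) - \<beta> * \<theta> i + \<theta> (i + 1) = c * \<gamma>)"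
    unfolding three_term_recurrent_def by simp
  also have "\<dots> \<longleftrightarrow> three_term_recurrent d \<theta>"
    unfolding three_term_recurrent_def
    using assms by (metis nonzero_mult_div_cancel_left times_divide_eq_right)
  finally show ?thesis .
qed

theorem theorem1p1:
  fixes adj :: "'v::finite \<Rightarrow> 'v \<Rightarrow> bool"
    and E :: "complex^'v^'v"
    and \<theta> :: "nat \<Rightarrow> complex"
  assumes "distance_regular adj"
    and "diam adj \<ge> 3"
    and "nontrivial_minimal_idempotent adj E"
    and "dual_eigenvalues adj E \<theta>"
  shows "Q_polynomial adj E \<longleftrightarrow>
           tail adj E \<and>
           three_term_recurrent (diam adj) \<theta> \<and>
           (\<forall>i \<in> {1..diam adj}. \<theta> i \<noteq> \<theta> 0)"
proof -
  interpret drg adj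
    by standard (rule assms(1))
  define n where "n = complex_of_nat CARD('v)"
  have n: "n \<noteq> 0"
    by (simp add: n_def)
  define \<phi> where "\<phi> i = \<theta> i / n" for i
  have E: "E $ x $ y = \<phi> (gdist adj x y)" for x y
    using assms(4) unfolding dual_eigenvalues_def
    by (metis \<phi>_def distance_matrix_sum_nth mscale_nth n_def times_divide_eq_left mult_1)
  have EM: "E \<in> mins" "E \<noteq> trivial_idempotent"
    using assms(3) by (simp_all add: nontrivial_minimal_idempotent_def)
  have ttr: "three_term_recurrent d \<phi> \<longleftrightarrow> three_term_recurrent d \<theta>"
    unfolding \<phi>_def using n by (rule three_term_recurrent_scale)
  have neq: "\<phi> i \<noteq> \<phi> 0 \<longleftrightarrow> \<theta> i \<noteq> \<theta> 0" for i
    using n by (simp add: \<phi>_def)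
  have "(\<exists>Es. Q_path E Es) \<longleftrightarrow>
      tail adj E \<and> three_term_recurrent d \<phi> \<and> (\<forall>i \<in> {1..d}. \<phi> i \<noteq> \<phi> 0)"
  proof
    assume "\<exists>Es. Q_path E Es"
    then obtain Es where Q: "Q_path E Es" ..
    \<comment> \<open>Equality would identify an entry at distance \<open>i\<close> with a diagonal
      entry.\<close>
    have "\<phi> i \<noteq> \<phi> 0" if i: "i \<in> {1..d}" for i
    proof
      assume "\<phi> i = \<phi> 0"
      moreover obtain x y where "gdist adj x y = i"
        using ex_gdist[of i] i by (metis atLeastAtMost_iff)
      ultimately have "E $ x $ y = E $ x $ x"
        by (simp add: E)
      from Q_path_entries_distinct[OF Q this] show False
        using \<open>gdist adj x y = i\<close> i by simp
    qed
    then show "tail adj E \<and> three_term_recurrent d \<phi> \<and> (\<forall>i \<in> {1..d}. \<phi> i \<noteq> \<phi> 0)"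
      using Q_path_tail[OF Q] Q_path_recurrence[OF Q assms(2) E] three_term_recurrentI assms(2) by auto
  next
    assume "tail adj E \<and> three_term_recurrent d \<phi> \<and> (\<forall>i \<in> {1..d}. \<phi> i \<noteq> \<phi> 0)"
    then show "\<exists>Es. Q_path E Es"
      using EM E assms(2) by (intro Q_path_exists[where \<phi> = \<phi>]) auto
  qed
  then show ?thesis
    using Q_polynomial_iff_Q_path[of E] assms(2) by (simp add: ttr neq)
qed

end
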